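(* Let $W$ be the Coxeter group of type $A_3$, let $c=(s_1,s_2,s_3)$ and $Q=c^m$ with $m\ge3$. Let $\mathbf a=\{a_i,b_i,c_i\}_{i=1,\dots,m}$ be any choice of real parameters satisfying the $c$-signature inequalities $$a_i-a_{i-1}>0,\qquad b_i-b_{i-1}>0,\qquad c_i-c_{i-1}>0\qquad(2\le i\le m),$$ $$2b_i-c_i-a_{i-1}+2b_j-c_j-a_{j-1}>0\qquad(2\le i,j\le m,\ i\ne j),$$ $$c_{i+1}+a_i-2b_i+c_{j+1}+a_j-2b_j>0\qquad(1\le i,j\le m-1,\ i\neq j).$$ Let $D_{123,\mathbf a}=\big(\widetilde D^{\mathbf a}_m\,|\,\cdots\,|\,\widetilde D^{\mathbf a}_1\big)$ be the $6\times 3m$ matrix with blocks $$\widetilde D_i^{\mathbf a}=\begin{pmatrix}1&0&0\\ a_i&m-b_i+1&0\\ \binom{a_i+1}{2}&(m-b_i+1)\,b_i&\binom{m-c_i+2}{2}\\ 0&1&0\\ 0&b_i&m-c_i+1\\ 0&0&1\end{pmatrix},$$ and let $M_{123,\mathbf a}$ be any Gale dual matrix of $D_{123,\mathbf a}$. Then the fan $\mathcal F_{Q,M_{123,\mathbf a}}$ is a complete fan realizing the subword complex $\mathcal{SC}(Q)$.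
   Context: Type $A_3$: $W$ is the symmetric group on 4 letters with $s_i=(i\ \ i+1)$; $w_\circ$ is its longest element, of length $N=6$. $c^m$ is the concatenation of $m$ copies of the word $c$, with $r=3m$ letters. For real $x$, $\binom{x}{2}=x(x-1)/2$. Subword complex: $\mathcal{SC}(Q)$, for a word $Q=(q_1,\dots,q_r)$, is the simplicial complex whose faces are the subsets $I\subset[r]$ such that the subword of $Q$ with positions in $[r]\smallsetminus I$ contains a reduced expression of $w_\circ$ as a subword. Gale dual: for a full rank matrix $A$, $B$ is a Gale dual matrix of $A$ if the rows of $B$ form a basis of $\ker A$. Fan: for $M\in\mathbb R^{(r-N)\times r}$ with columns $M_1,\dots,M_r$, $\mathcal F_{Q,M}$ is the collection of cones $\operatorname{cone}(M_i:i\in I)\subset\mathbb R^{r-N}$ for $I$ a face of $\mathcal{SC}(Q)$. It is a complete (simplicial) fan realizing $\mathcal{SC}(Q)$ if for every face $I$ the vectors $(M_i)_{i\in I}$ are linearly independent, the cones of any two faces $I,J$ intersect exactly in the cone of $I\cap J$, and the union of all cones is $\mathbb R^{r-N}$. *)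

theory Defs
  imports
    "HOL-Combinatorics.Permutations"
    "HOL-Library.Sublist"
    "Jordan_Normal_Form.Matrix_Kernel"
begin

section \<open>The Coxeter group of type \<open>A\<^sub>3\<close>\<close>

text \<open>
  The group is the set of permutations of \<open>{1..4}\<close>, with simple reflections
  \<open>s 1, s 2, s 3\<close>. Words are lists of the indices \<open>1, 2, 3\<close> of the reflections.
\<close>

definition s :: "nat \<Rightarrow> nat \<Rightarrow> nat" where
  "s i = transpose i (i + 1)"

definition word_prod :: "nat list \<Rightarrow> nat \<Rightarrow> nat" where
  "word_prod ws = foldr (\<circ>) (map s ws) id"

definition expression :: "nat list \<Rightarrow> (nat \<Rightarrow> nat) \<Rightarrow> bool" where
  "expression ws w \<longleftrightarrow> set ws \<subseteq> {1..3} \<and> word_prod ws = w"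

definition cox_length :: "(nat \<Rightarrow> nat) \<Rightarrow> nat" where
  "cox_length w = (LEAST k. \<exists>ws. expression ws w \<and> length ws = k)"

definition reduced_expression :: "nat list \<Rightarrow> (nat \<Rightarrow> nat) \<Rightarrow> bool" where
  "reduced_expression ws w \<longleftrightarrow> expression ws w \<and> length ws = cox_length w"

definition w0 :: "nat \<Rightarrow> nat" where
  "w0 = (ARG_MAX cox_length w. w permutes {1..4})"


section \<open>Subword complexes and their fans\<close>

text \<open>
  Positions in a word \<open>Q\<close> of length \<open>r\<close> are counted from \<open>0\<close>, as are the columns of
  matrices, so that \<open>{..<r}\<close> plays the role of \<open>[r] = {1,\<dots>,r}\<close>.
\<close>

definition subword_complex :: "nat list \<Rightarrow> nat set set" where
  "subword_complex Q = {I. I \<subseteq> {..<length Q} \<and>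
     (\<exists>ws. reduced_expression ws w0 \<and> subseq ws (nths Q ({..<length Q} - I)))}"

definition cone_cols :: "real mat \<Rightarrow> nat set \<Rightarrow> real vec set" where
  "cone_cols M I =
     {finsum_vec TYPE(real) (dim_row M) (\<lambda>i. x i \<cdot>\<^sub>v col M i) I | x :: nat \<Rightarrow> real. \<forall>i\<in>I. 0 \<le> x i}"

definition fan :: "nat list \<Rightarrow> real mat \<Rightarrow> real vec set set" where
  "fan Q M = cone_cols M ` subword_complex Q"

text \<open>Injectivity of \<open>col M\<close> on \<open>I\<close> is needed because \<open>lin_dep\<close> is a property of a set
  of vectors, not of a family.\<close>

definition lin_indpt_cols :: "real mat \<Rightarrow> nat set \<Rightarrow> bool" where
  "lin_indpt_cols M I \<longleftrightarrow> inj_on (col M) I \<and>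
     \<not> module.lin_dep class_ring (module_vec TYPE(real) (dim_row M)) (col M ` I)"

text \<open>The first conjunct states that the ambient space of the fan has dimension
  \<open>r - N\<close>, with \<open>r = length Q\<close> and \<open>N = cox_length w0\<close>.\<close>

definition complete_fan_realizing :: "nat list \<Rightarrow> real mat \<Rightarrow> bool" where
  "complete_fan_realizing Q M \<longleftrightarrow>
     M \<in> carrier_mat (length Q - cox_length w0) (length Q) \<and>
     (\<forall>I\<in>subword_complex Q. lin_indpt_cols M I) \<and>
     (\<forall>I\<in>subword_complex Q. \<forall>J\<in>subword_complex Q.
        cone_cols M I \<inter> cone_cols M J = cone_cols M (I \<inter> J)) \<and>
     \<Union> (fan Q M) = carrier_vec (length Q - cox_length w0)"


section \<open>Gale duality\<close>

text \<open>
  The rows of \<open>B\<close>, as a family, form a basis of the kernel of \<open>A\<close>. The full rank of \<open>A\<close>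
  is not part of the definition: by rank-nullity, \<open>A\<close> has full row rank if and only if
  a Gale dual has \<open>dim_col A - dim_row A\<close> rows, and
  \<^const>\<open>complete_fan_realizing\<close> asserts this number of rows.
\<close>

definition gale_dual :: "real mat \<Rightarrow> real mat \<Rightarrow> bool" where
  "gale_dual A B \<longleftrightarrow> dim_col B = dim_col A \<and> distinct (rows B) \<and>
     kernel.basis (dim_col A) A (set (rows B))"


section \<open>The parameter matrix\<close>

lemma gchoose_2_real: "(x :: real) gchoose 2 = x * (x - 1) / 2"
  by (simp add: gbinomial_prod_rev numeral_2_eq_2)

definition D_block :: "nat \<Rightarrow> real \<Rightarrow> real \<Rightarrow> real \<Rightarrow> real mat" where
  "D_block m a b c = mat_of_rows_list 3
     [[1,                  0,                         0],
      [a,                  real m - b + 1,            0],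
      [(a + 1) gchoose 2,  (real m - b + 1) * b,      (real m - c + 2) gchoose 2],
      [0,                  1,                         0],
      [0,                  b,                         real m - c + 1],
      [0,                  0,                         1]]"

text \<open>The blocks, with parameters indexed by \<open>1,\<dots>,m\<close>, are placed side by side in
  decreasing order \<open>m,\<dots>,1\<close>.\<close>

definition D_123 :: "nat \<Rightarrow> (nat \<Rightarrow> real) \<Rightarrow> (nat \<Rightarrow> real) \<Rightarrow> (nat \<Rightarrow> real) \<Rightarrow> real mat" where
  "D_123 m a b c = mat 6 (3 * m)
     (\<lambda>(k, j). let i = m - j div 3 in D_block m (a i) (b i) (c i) $$ (k, j mod 3))"

end

theory Submission
  imports Defs "HOL-Computational_Algebra.Polynomial"
begin

text \<open>
  Dually, a vector of the ambient space is a point \<open>X\<close> of \<open>\<real>\<^sup>r\<close> modulo the row space of \<open>D\<close>, and it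
  lies in the cone of a face iff some \<open>X + y\<close>, with \<open>y\<close> in the row space, is nonnegative and
  vanishes on a reduced word of \<open>w\<^sub>0\<close>. Everything reduces to a sign property of the row space: if
  the positions with \<open>y \<ge> 0\<close> and those with \<open>y \<le> 0\<close> both contain \<open>w\<^sub>0\<close>, then \<open>y = 0\<close>. It gives
  linear independence and the intersection property at once. For completeness, walk along a generic
  line that starts inside a cone: adjacent facets lie on opposite sides of their common wall, again
  by the sign property, so the walk never leaves the union of the cones.

  The sign property only uses that words of \<open>w\<^sub>0\<close> contain \<open>123\<close>, \<open>321\<close> and \<open>2132\<close> or \<open>2312\<close>.
  Elements of the row space are triples of quadratic polynomials \<open>f, g, h\<close>, evaluated at the
  \<open>a\<^sub>i, b\<^sub>i, c\<^sub>i\<close>, whose divided differences satisfy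
  \<open>f[a,a'] + g[b,b'] + h[c,c'] = F\<^sub>2 (a + a' + c + c' - 2 b - 2 b')\<close>; the signature inequalities
  fix the sign of the right-hand side.
\<close>

section \<open>Words for the longest element\<close>

text \<open>One-line notation: it determines a permutation of \<open>{1..4}\<close>, so equalities
  of functions become equalities of lists that evaluation can decide.\<close>

definition oneline :: "nat list \<Rightarrow> nat list" where
  "oneline ws = map (word_prod ws) [1, 2, 3, 4]"

lemma oneline_Nil: "oneline [] = [1, 2, 3, 4]"
  by (simp add: oneline_def word_prod_def)

lemma oneline_Cons: "oneline (k # ws) = map (\<lambda>x. if x = k then k + 1 else if x = k + 1 then k else x) (oneline ws)"
  by (simp add: oneline_def word_prod_def s_def transpose_def)

lemma oneline_code [code]:
  "oneline ws = foldr (\<lambda>k. map (\<lambda>x. if x = k then k + 1 else if x = k + 1 then k else x)) ws [1, 2, 3, 4]"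
  by (induction ws) (simp_all add: oneline_Nil oneline_Cons)

text \<open>The 16 reduced words of \<open>w0\<close>, in colexicographic order:
  \<open>List.n_lists\<close> enumerates that way, and \<open>filter_longest_words\<close> is an
  equality of lists.\<close>

definition longest_words :: "nat list list" where
  "longest_words =
     [[1, 2, 3, 1, 2, 1], [1, 2, 1, 3, 2, 1], [2, 1, 2, 3, 2, 1], [2, 3, 1, 2, 3, 1],
      [2, 1, 3, 2, 3, 1], [1, 2, 3, 2, 1, 2], [3, 1, 2, 3, 1, 2], [1, 3, 2, 3, 1, 2],
      [3, 1, 2, 1, 3, 2], [1, 3, 2, 1, 3, 2], [3, 2, 1, 2, 3, 2], [2, 3, 1, 2, 1, 3],
      [2, 1, 3, 2, 1, 3], [2, 3, 2, 1, 2, 3], [3, 2, 3, 1, 2, 3], [3, 2, 1, 3, 2, 3]]"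

lemma filter_longest_words:
  "filter (\<lambda>ws. oneline ws = [4, 3, 2, 1]) (List.n_lists 6 [1, 2, 3]) = longest_words"
  by code_simp

lemma oneline_short_words:
  "\<forall>k\<in>set [0..<6]. \<forall>ws\<in>set (List.n_lists k [1, 2, 3]). oneline ws \<noteq> [4, 3, 2, 1]"
  by code_simp

text \<open>Coset normal form: the 2 * 3 * 4 products \<open>x @ y @ z\<close> run once through the
  symmetric group, and only the one with all factors of full length has 1 + 2 + 3 = 6 letters; it is
  the reversal.\<close>

lemma short_word_exists:
  "\<forall>p\<in>set [1, 2, 3, 4]. \<forall>q\<in>set [1, 2, 3, 4]. \<forall>r\<in>set [1, 2, 3, 4]. \<forall>t\<in>set [1, 2, 3, 4].
     distinct [p, q, r, t] \<longrightarrow> [p, q, r, t] \<noteq> [4, 3, 2, 1] \<longrightarrow>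
     (\<exists>x\<in>set [[], [1]]. \<exists>y\<in>set [[], [2], [2, 1]]. \<exists>z\<in>set [[], [3], [3, 2], [3, 2, 1]].
        length (x @ y @ z) < 6 \<and> oneline (x @ y @ z) = [p, q, r, t])"
  by code_simp


lemma longest_words_subseqs:
  "\<forall>ws\<in>set longest_words. length ws = 6 \<and> subseq [1, 2, 3] ws \<and> subseq [3, 2, 1] ws \<and>
     (subseq [2, 1, 3, 2] ws \<or> subseq [2, 3, 1, 2] ws)"
  by code_simp

text \<open>Strong exchange: inserting \<open>k\<close> at the gap \<open>p\<close> multiplies
  \<open>w0\<close> by a reflection, which always shortens the longest element; hence deleting a
  suitable old letter \<open>q\<close> compensates for the insertion. The two branches are a
  deletion to the left and to the right of the gap.\<close>

lemma longest_words_exchange_aux: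
  "\<forall>ws\<in>set longest_words. \<forall>k\<in>set [1, 2, 3]. \<forall>p\<in>set [0..<7]. \<exists>q\<in>set [0..<6].
     (if q < p then take q ws @ drop (Suc q) (take p ws) @ [k] @ drop p ws
      else take p ws @ [k] @ take (q - p) (drop p ws) @ drop (Suc q) ws) \<in> set longest_words"
  unfolding longest_words_def
  by code_simp

section \<open>Coxeter length and the longest element\<close>

lemma permutes_eq_iff_map:
  fixes w v :: "nat \<Rightarrow> nat"
  assumes "w permutes {1..4}" "v permutes {1..4}"
  shows "w = v \<longleftrightarrow> map w [1, 2, 3, 4] = map v [1, 2, 3, 4]"
proof
  assume eq: "map w [1, 2, 3, 4] = map v [1, 2, 3, 4]"
  show "w = v"
  proof
    fix x :: nat
    consider "x \<notin> {1..4}" | "x = 1" | "x = 2" | "x = 3" | "x = 4" by force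
    then show "w x = v x"
      using eq assms by cases (simp_all add: permutes_not_in)
  qed
qed simp

lemma word_prod_permutes: "set ws \<subseteq> {1..3} \<Longrightarrow> word_prod ws permutes {1..4}"
proof (induction ws)
  case Nil
  have "word_prod [] = id" by (simp add: word_prod_def)
  then show ?case by (simp only: permutes_id)
next
  case (Cons k ws)
  have "s k permutes {1..4}"
    unfolding s_def using Cons.prems by (intro permutes_swap_id) auto
  moreover have "word_prod (k # ws) = s k \<circ> word_prod ws" by (simp add: word_prod_def)
  moreover have "word_prod ws permutes {1..4}" using Cons by simp
  ultimately show ?case using permutes_compose by metis
qed

lemma expression_iff:
  assumes "w permutes {1..4}"
  shows "expression ws w \<longleftrightarrow> set ws \<subseteq> {1..3} \<and> oneline ws = map w [1, 2, 3, 4]"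
  using permutes_eq_iff_map[OF word_prod_permutes assms]
  unfolding expression_def oneline_def by auto

lemma words_123: "set ws \<subseteq> {1..3} \<longleftrightarrow> ws \<in> set (List.n_lists (length ws) [1, 2, 3 :: nat])"
proof -
  have "{1..3} = set [1, 2, 3 :: nat]" by (auto simp: numeral_eq_Suc)
  then show ?thesis by (simp only: set_n_lists) blast
qed

lemma cox_length_le: "expression ws w \<Longrightarrow> cox_length w \<le> length ws"
  unfolding cox_length_def by (rule Least_le) auto

text \<open>Leaves the reversal as the only candidate for a maximum of
  \<open>cox_length\<close>.\<close>

lemma cox_length_less_6:
  assumes w: "w permutes {1..4}" and neq: "map w [1, 2, 3, 4] \<noteq> [4, 3, 2, 1]"
  shows "cox_length w < 6"
proof -
  have mem: "w x \<in> set [1, 2, 3, 4]" if "x \<in> {1..4}" for x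
  proof -
    have "w x \<in> {1..4}" using permutes_in_image[OF w, of x] that by blast
    moreover have "{1..4} = set [1, 2, 3, 4 :: nat]" by (auto simp: numeral_eq_Suc)
    ultimately show ?thesis by blast
  qed
  have dist: "distinct [w 1, w 2, w 3, w 4]"
    using permutes_inj[OF w] by (simp add: inj_eq)
  have "\<exists>x\<in>set [[], [1]]. \<exists>y\<in>set [[], [2], [2, 1]]. \<exists>z\<in>set [[], [3], [3, 2], [3, 2, 1]].
        length (x @ y @ z) < 6 \<and> oneline (x @ y @ z) = [w 1, w 2, w 3, w 4]"
  proof (rule short_word_exists[THEN bspec, THEN bspec, THEN bspec, THEN bspec, THEN mp, THEN mp])
    show "[w 1, w 2, w 3, w 4] \<noteq> [4, 3, 2, 1]" using neq by simp
  qed (simp_all only: dist, (rule mem, simp)+)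
  then obtain x y z where xyz: "x \<in> set [[], [1]]" "y \<in> set [[], [2], [2, 1]]"
      "z \<in> set [[], [3], [3, 2], [3, 2, 1]]" "length (x @ y @ z) < 6"
      "oneline (x @ y @ z) = [w 1, w 2, w 3, w 4]"
    by blast
  have "set (x @ y @ z) \<subseteq> {1..3}" using xyz(1-3) by auto
  then have "expression (x @ y @ z) w" using xyz(5) w by (simp add: expression_iff)
  from cox_length_le[OF this] xyz(4) show ?thesis by simp
qed

lemma cox_length_longest:
  assumes w: "w permutes {1..4}" and eq: "map w [1, 2, 3, 4] = [4, 3, 2, 1]"
  shows "cox_length w = 6"
proof -
  have "[1, 2, 3, 1, 2, 1] \<in> set longest_words" by (simp add: longest_words_def)
  then have "oneline [1, 2, 3, 1, 2, 1] = [4, 3, 2, 1]"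
    unfolding filter_longest_words[symmetric] by auto
  then have e: "expression [1, 2, 3, 1, 2, 1] w" using w eq by (simp add: expression_iff)
  have "6 \<le> length ws" if "expression ws w" for ws
  proof (rule ccontr)
    assume "\<not> 6 \<le> length ws"
    then have "length ws \<in> set [0..<6]" by auto
    moreover have "ws \<in> set (List.n_lists (length ws) [1, 2, 3])"
      using that words_123 by (simp add: expression_def)
    ultimately have "oneline ws \<noteq> [4, 3, 2, 1]" using oneline_short_words by blast
    then show False using that w eq by (simp add: expression_iff)
  qed
  then show ?thesis unfolding cox_length_def using e
    by (intro Least_equality) (force, blast)
qed

lemma w0_permutes: "w0 permutes {1..4}"
  and w0_oneline: "map w0 [1, 2, 3, 4] = [4, 3, 2, 1]"
proof -
  let ?r = "word_prod [1, 2, 3, 1, 2, 1]"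
  have r: "?r permutes {1..4}" by (rule word_prod_permutes) simp
  have "[1, 2, 3, 1, 2, 1] \<in> set longest_words" by (simp add: longest_words_def)
  then have "map ?r [1, 2, 3, 4] = [4, 3, 2, 1]"
    unfolding filter_longest_words[symmetric] oneline_def by auto
  note r6 = cox_length_longest[OF r this]
  \<comment> \<open>\<open>w0\<close> is a choice among maximisers, so nothing is known about it
    until some maximiser is exhibited.\<close>
  have "is_arg_max cox_length (\<lambda>w. w permutes {1..4}) ?r"
    unfolding is_arg_max_def using r r6 cox_length_less_6 cox_length_longest
    by (metis less_irrefl order_less_imp_not_less)
  then have max: "is_arg_max cox_length (\<lambda>w. w permutes {1..4}) w0"
    unfolding w0_def arg_max_def by (rule someI[of "is_arg_max cox_length (\<lambda>w. w permutes {1..4})"])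
  then show p: "w0 permutes {1..4}" by (simp add: is_arg_max_def)
  have "\<not> cox_length w0 < 6" using max r r6 unfolding is_arg_max_def by metis
  then show "map w0 [1, 2, 3, 4] = [4, 3, 2, 1]" using cox_length_less_6[OF p] by blast
qed

lemma cox_length_w0: "cox_length w0 = 6"
  by (rule cox_length_longest[OF w0_permutes w0_oneline])

lemma reduced_expression_w0: "reduced_expression ws w0 \<longleftrightarrow> ws \<in> set longest_words"
proof -
  have "reduced_expression ws w0 \<longleftrightarrow>
      ws \<in> set (List.n_lists (length ws) [1, 2, 3]) \<and> length ws = 6 \<and> oneline ws = [4, 3, 2, 1]"
    unfolding reduced_expression_def expression_iff[OF w0_permutes] words_123 cox_length_w0
      w0_oneline by auto
  also have "\<dots> \<longleftrightarrow> ws \<in> set longest_words"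
    unfolding filter_longest_words[symmetric] by (auto simp: set_n_lists)
  finally show ?thesis .
qed

lemma longest_words_exchange:
  assumes uv: "u @ v \<in> set longest_words" and k: "k \<in> {1, 2, 3}"
  shows "(\<exists>x y z. u = x @ y # z \<and> x @ z @ k # v \<in> set longest_words) \<or>
    (\<exists>x y z. v = x @ y # z \<and> u @ k # x @ z \<in> set longest_words)"
proof -
  have len: "length (u @ v) = 6" using uv longest_words_subseqs by blast
  have "length u \<in> set [0..<7]" using len by auto
  then obtain q where q: "q < 6" and
    w: "(if q < length u then take q (u @ v) @ drop (Suc q) (take (length u) (u @ v)) @ [k] @ drop (length u) (u @ v)
      else take (length u) (u @ v) @ [k] @ take (q - length u) (drop (length u) (u @ v)) @ drop (Suc q) (u @ v))
      \<in> set longest_words"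
    using bspec[OF bspec[OF bspec[OF longest_words_exchange_aux uv], of k] \<open>length u \<in> set [0..<7]\<close>] k
    by fastforce
  show ?thesis
  proof (cases "q < length u")
    case True
    then have "take q u @ drop (Suc q) u @ k # v \<in> set longest_words" using w by simp
    then show ?thesis using id_take_nth_drop[OF True] by blast
  next
    case False
    then have 1: "q - length u < length v" using q len by auto
    have "u @ k # take (q - length u) v @ drop (Suc (q - length u)) v \<in> set longest_words"
      using w False by (simp add: Suc_diff_le not_less)
    then show ?thesis using id_take_nth_drop[OF 1] by blast
  qed
qed

section \<open>Subwords as sets of positions\<close>

lemma nths_delete:
  assumes "nths L A = x @ y # z"
  shows "\<exists>j\<in>A. nths L (A - {j}) = x @ z"
  using assms
proof (induction L arbitrary: A x)
  case (Cons a L)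
  let ?A = "{j. Suc j \<in> A}"
  show ?case
  proof (cases "0 \<in> A \<and> x = []")
    case True
    then have "nths (a # L) (A - {0}) = z" using Cons.prems by (simp add: nths_Cons)
    then show ?thesis using True by auto
  next
    case False
    obtain x' where x': "nths L ?A = x' @ y # z" "x = (if 0 \<in> A then [a] else []) @ x'"
      using Cons.prems False by (cases x) (auto simp: nths_Cons split: if_splits)
    from Cons.IH[OF x'(1)] obtain j where "Suc j \<in> A" "nths L (?A - {j}) = x' @ z" by auto
    moreover have "{i. Suc i \<in> A - {Suc j}} = ?A - {j}" by auto
    ultimately show ?thesis using x'(2)
      by (intro bexI[of _ "Suc j"]) (auto simp: nths_Cons)
  qed
qed simp

lemma nths_split:
  assumes "i < length Q"
  shows "nths Q A = nths Q (A \<inter> {..<i}) @ (if i \<in> A then [Q ! i] else []) @ nths Q (A \<inter> {i<..})"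
  using assms
proof (induction Q arbitrary: i A)
  case (Cons a Q)
  show ?case
  proof (cases i)
    case 0
    have "{j. Suc j \<in> A \<inter> {0<..}} = {j. Suc j \<in> A}" by auto
    with 0 show ?thesis by (simp add: nths_Cons)
  next
    case (Suc i')
    have e: "{j. Suc j \<in> A \<inter> {..<i}} = {j. Suc j \<in> A} \<inter> {..<i'}"
      "{j. Suc j \<in> A \<inter> {i<..}} = {j. Suc j \<in> A} \<inter> {i'<..}" using Suc by auto
    show ?thesis using Cons.IH[of i' "{j. Suc j \<in> A}"] Cons.prems Suc
      unfolding nths_Cons e by auto
  qed
qed simp

lemma subseq_nths_positions:
  assumes "subseq xs (nths Q P)"
  obtains js where "sorted_wrt (<) js" "set js \<subseteq> P \<inter> {..<length Q}" "map ((!) Q) js = xs"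
proof -
  obtain N where "xs = nths (nths Q P) N" using assms by (auto simp: subseq_conv_nths)
  then obtain N' where N': "xs = nths Q N'" "N' \<subseteq> P" by (auto simp: nths_nths)
  have "nths Q N' = nths (map ((!) Q) [0..<length Q]) N'" by (simp add: map_nth)
  also have "\<dots> = map ((!) Q) (nths [0..<length Q] N')" by (simp add: nths_map)
  finally have "map ((!) Q) (nths [0..<length Q] N') = xs" using N' by simp
  moreover have "sorted_wrt (<) (nths [0..<length Q] N')"
    by (simp add: strict_sorted_iff sorted_nths)
  moreover have "set (nths [0..<length Q] N') \<subseteq> P \<inter> {..<length Q}"
    using N'(2) by (auto simp: set_nths)
  ultimately show ?thesis using that by blast
qed

section \<open>Facets of the subword complex\<close>

definition facet_complements :: "nat list \<Rightarrow> nat set set" where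
  "facet_complements Q = {P. P \<subseteq> {..<length Q} \<and> nths Q P \<in> set longest_words}"

lemma card_facet_complement:
  assumes "P \<in> facet_complements Q"
  shows "card P = 6"
proof -
  have "length (nths Q P) = 6" and P: "P \<subseteq> {..<length Q}"
    using assms longest_words_subseqs unfolding facet_complements_def by blast+
  moreover have "{i. i < length Q \<and> i \<in> P} = P" using P by auto
  ultimately show ?thesis by (simp add: length_nths)
qed

lemma subword_complex_iff:
  "I \<in> subword_complex Q \<longleftrightarrow>
     I \<subseteq> {..<length Q} \<and> (\<exists>P\<in>facet_complements Q. P \<inter> I = {})"
proof -
  have "(\<exists>ws. ws \<in> set longest_words \<and> subseq ws (nths Q ({..<length Q} - I))) \<longleftrightarrow>
      (\<exists>P\<in>facet_complements Q. P \<inter> I = {})" (is "?l \<longleftrightarrow> ?r")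
  proof
    assume ?l
    then obtain ws N where ws: "ws \<in> set longest_words" "ws = nths (nths Q ({..<length Q} - I)) N"
      by (auto simp: subseq_conv_nths)
    then obtain P where "ws = nths Q P" "P \<subseteq> {..<length Q} - I"
      unfolding nths_nths by blast
    then show ?r using ws unfolding facet_complements_def by blast
  next
    assume ?r
    then obtain P where P: "P \<subseteq> {..<length Q} - I" "nths Q P \<in> set longest_words"
      unfolding facet_complements_def by blast
    \<comment> \<open>Writing the inclusion of \<open>P\<close> as an intersection gives an
      unconditional claim, fit for induction over \<open>Q\<close>.\<close>
    have "nths Q P = nths Q (P \<inter> ({..<length Q} - I))" using P(1) by (simp add: Int_absorb2)
    also have "subseq \<dots> (nths Q ({..<length Q} - I))"
    proof (induction Q arbitrary: P I)
      case (Cons a Q)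
      let ?B = "{j. Suc j \<in> {..<length (a # Q)} - I}"
      have "?B = {..<length Q} - {j. Suc j \<in> I}" by auto
      moreover have "{j. Suc j \<in> P \<inter> ({..<length (a # Q)} - I)} = {j. Suc j \<in> P} \<inter> ({..<length Q} - {j. Suc j \<in> I})"
        by auto
      ultimately show ?case using Cons.IH[of "{j. Suc j \<in> P}" "{j. Suc j \<in> I}"]
        by (auto simp: nths_Cons)
    qed simp
    finally show ?l using P(2) by blast
  qed
  then show ?thesis unfolding subword_complex_def reduced_expression_w0 by blast
qed

text \<open>The complex has no boundary: the wall obtained by removing \<open>i\<close> from the
  facet opposite to \<open>P\<close> also lies in a second facet, the one that contains
  \<open>j\<close> instead. The letters to the left and to the right of \<open>i\<close> are the
  \<open>u\<close> and \<open>v\<close> of \<open>longest_words_exchange\<close>.\<close>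

lemma facet_complements_exchange:
  assumes P: "P \<in> facet_complements Q" and i: "i < length Q" "i \<notin> P" "Q ! i \<in> {1, 2, 3}"
  shows "\<exists>j\<in>P. insert i P - {j} \<in> facet_complements Q"
proof -
  let ?l = "P \<inter> {..<i}" and ?r = "P \<inter> {i<..}"
  have "nths Q ?l @ nths Q ?r \<in> set longest_words"
    using P nths_split[OF i(1), of P] i(2) by (simp add: facet_complements_def)
  from longest_words_exchange[OF this i(3)]
  have "\<exists>j\<in>P. nths Q (insert i P - {j}) \<in> set longest_words"
  proof (elim disjE exE conjE)
    fix x y z assume u: "nths Q ?l = x @ y # z"
      and w: "x @ z @ Q ! i # nths Q ?r \<in> set longest_words"
    from nths_delete[OF u] obtain j where j: "j \<in> ?l" "nths Q (?l - {j}) = x @ z" by blast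
    have "(insert i P - {j}) \<inter> {..<i} = ?l - {j}" "(insert i P - {j}) \<inter> {i<..} = ?r" using j by auto
    then have "nths Q (insert i P - {j}) = x @ z @ Q ! i # nths Q ?r"
      using nths_split[OF i(1), of "insert i P - {j}"] j by auto
    then show ?thesis using j(1) w by (intro bexI[of _ j]) simp_all
  next
    fix x y z assume u: "nths Q ?r = x @ y # z"
      and w: "nths Q ?l @ Q ! i # x @ z \<in> set longest_words"
    from nths_delete[OF u] obtain j where j: "j \<in> ?r" "nths Q (?r - {j}) = x @ z" by blast
    have "(insert i P - {j}) \<inter> {..<i} = ?l" "(insert i P - {j}) \<inter> {i<..} = ?r - {j}" using j by auto
    then have "nths Q (insert i P - {j}) = nths Q ?l @ Q ! i # x @ z"
      using nths_split[OF i(1), of "insert i P - {j}"] j by auto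
    then show ?thesis using j(1) w by (intro bexI[of _ j]) simp_all
  qed
  then show ?thesis using P i(1) by (auto simp: facet_complements_def)
qed

section \<open>Sign patterns of the row space\<close>

text \<open>\<open>A, B, C\<close> are the blocks containing a letter \<open>1, 2, 3\<close>. Blocks decrease along the word, so the
  three conditions describe the subwords \<open>123\<close>, \<open>321\<close>, and \<open>2132\<close> or \<open>2312\<close>, read from right to left.\<close>

definition w0_pattern :: "nat set \<Rightarrow> nat set \<Rightarrow> nat set \<Rightarrow> bool" where
  "w0_pattern A B C \<longleftrightarrow>
     (\<exists>k\<in>C. \<exists>j\<in>B. \<exists>i\<in>A. k \<le> j \<and> j \<le> i) \<and>
     (\<exists>i\<in>A. \<exists>j\<in>B. \<exists>k\<in>C. i < j \<and> j < k) \<and>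
     (\<exists>l\<in>B. \<exists>u\<in>B. \<exists>i\<in>A. \<exists>k\<in>C. l \<le> i \<and> i < u \<and> l < k \<and> k \<le> u)"

lemma w0_pattern_mono:
  "w0_pattern A B C \<Longrightarrow> A \<subseteq> A' \<Longrightarrow> B \<subseteq> B' \<Longrightarrow> C \<subseteq> C' \<Longrightarrow> w0_pattern A' B' C'"
  unfolding w0_pattern_def by (meson subsetD)

section \<open>Divided differences of quadratic polynomials\<close>

lemma quadratic_diff:
  fixes x y :: real
  shows "(p0 + p1 * y + p2 * y\<^sup>2) - (p0 + p1 * x + p2 * x\<^sup>2) = (y - x) * (p1 + p2 * (x + y))"
  by (simp add: algebra_simps power2_eq_square)

text \<open>\<open>p1 + p2 * (x + y)\<close> is the divided difference; a sign change between
  \<open>x\<close> and \<open>y\<close> determines its sign.\<close>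

lemma quadratic_slope_nonneg:
  fixes x y :: real
  assumes "x < y" "p0 + p1 * x + p2 * x\<^sup>2 \<le> 0" "0 \<le> p0 + p1 * y + p2 * y\<^sup>2"
  shows "0 \<le> p1 + p2 * (x + y)"
proof -
  have "0 \<le> (y - x) * (p1 + p2 * (x + y))" using assms(2,3) quadratic_diff[of p0 p1 y p2 x] by linarith
  then show ?thesis using assms(1) by (simp add: zero_le_mult_iff)
qed

lemma quadratic_slope_nonpos:
  fixes x y :: real
  assumes "x < y" "0 \<le> p0 + p1 * x + p2 * x\<^sup>2" "p0 + p1 * y + p2 * y\<^sup>2 \<le> 0"
  shows "p1 + p2 * (x + y) \<le> 0"
  using quadratic_slope_nonneg[of x y "-p0" "-p1" "-p2"] assms by (simp add: algebra_simps)

text \<open>A nonnegative value at \<open>y\<close> would make the divided difference at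
  \<open>x, y\<close> nonnegative and the one at \<open>y, z\<close> nonpositive, although the
  second exceeds the first by \<open>p2 * (z - x)\<close>.\<close>

lemma quadratic_convex_neg:
  fixes x y z :: real
  assumes "p2 > 0" "x < y" "y < z" "p0 + p1 * x + p2 * x\<^sup>2 \<le> 0" "p0 + p1 * z + p2 * z\<^sup>2 \<le> 0"
  shows "p0 + p1 * y + p2 * y\<^sup>2 < 0"
proof (rule ccontr)
  assume "\<not> ?thesis"
  then have "0 \<le> p1 + p2 * (x + y)" "p1 + p2 * (y + z) \<le> 0"
    using assms quadratic_slope_nonneg[of x y p0 p1 p2] quadratic_slope_nonpos[of y z p0 p1 p2] by auto
  then have "p2 * (z - x) \<le> 0" by (simp add: algebra_simps)
  then show False using assms by (auto simp: mult_le_0_iff)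
qed

section \<open>The sign property from the signature inequalities\<close>

locale signature_parameters =
  fixes m :: nat and a b c :: "nat \<Rightarrow> real"
  assumes mono: "\<forall>i\<in>{2..m}. a i - a (i - 1) > 0 \<and> b i - b (i - 1) > 0 \<and> c i - c (i - 1) > 0"
    and lower: "\<forall>i\<in>{2..m}. \<forall>j\<in>{2..m}. i \<noteq> j \<longrightarrow>
           2 * b i - c i - a (i - 1) + 2 * b j - c j - a (j - 1) > 0"
    and upper: "\<forall>i\<in>{1..m - 1}. \<forall>j\<in>{1..m - 1}. i \<noteq> j \<longrightarrow>
           c (i + 1) + a i - 2 * b i + c (j + 1) + a j - 2 * b j > 0"
begin

lemma less:
  assumes "1 \<le> i" "i < j" "j \<le> m"
  shows "a i < a j" "b i < b j" "c i < c j"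
proof -
  have "k + i \<le> m \<Longrightarrow> k > 0 \<Longrightarrow> a i < a (k + i) \<and> b i < b (k + i) \<and> c i < c (k + i)" for k
  proof (induction k)
    case (Suc k)
    have "Suc (k + i) \<in> {2..m}" using Suc.prems assms(1) by auto
    from bspec[OF mono this] Suc show ?case by (cases k) auto
  qed simp
  from this[of "j - i"] show "a i < a j" "b i < b j" "c i < c j" using assms by auto
qed

lemma le:
  assumes "1 \<le> i" "i \<le> j" "j \<le> m"
  shows "a i \<le> a j" "b i \<le> b j" "c i \<le> c j"
  using less[of i j] assms by (cases "i = j"; simp add: less_imp_le)+



text \<open>All three quadratics change sign upwards, so their divided differences are nonnegative.
  In the sum the linear coefficients cancel, which leaves \<open>F2\<close> times an expression that
  \<open>lower\<close>, taken at \<open>j\<close> and \<open>u\<close>, makes negative.\<close>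

lemma no_low_crossing:
  assumes F2: "F2 > 0" and sum0: "F1 + G1 + H1 = 0"
    and ju: "1 < j" "j < u" "u \<le> m"
    and a: "1 \<le> i" "i < j" "i < i'" "i' < u"
      "F0 + F1 * a i + F2 * (a i)\<^sup>2 \<le> 0" "0 \<le> F0 + F1 * a i' + F2 * (a i')\<^sup>2"
    and b: "G0 + G1 * b j + (-2 * F2) * (b j)\<^sup>2 \<le> 0" "0 \<le> G0 + G1 * b u + (-2 * F2) * (b u)\<^sup>2"
    and c: "1 \<le> k" "k \<le> j" "k < k'" "k' \<le> u"
      "H0 + H1 * c k + F2 * (c k)\<^sup>2 \<le> 0" "0 \<le> H0 + H1 * c k' + F2 * (c k')\<^sup>2"
  shows False
proof -
  have "0 \<le> F1 + F2 * (a i + a i')"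
    by (rule quadratic_slope_nonneg[OF less(1) a(5,6)]) (use a ju in auto)
  moreover have "0 \<le> G1 + (-2 * F2) * (b j + b u)"
    by (rule quadratic_slope_nonneg[OF less(2) b]) (use ju in auto)
  moreover have "0 \<le> H1 + F2 * (c k + c k')"
    by (rule quadratic_slope_nonneg[OF less(3) c(5,6)]) (use c ju in auto)
  ultimately have "0 \<le> F2 * (a i + a i' + c k + c k' - 2 * b j - 2 * b u)"
    using sum0 by (simp add: algebra_simps)
  then have "0 \<le> a i + a i' + c k + c k' - 2 * b j - 2 * b u"
    using F2 by (simp add: zero_le_mult_iff)
  \<comment> \<open>The strict comparisons \<open>i < j\<close>, \<open>i' < u\<close> and the weak
    ones \<open>k \<le> j\<close>, \<open>k' \<le> u\<close> produce exactly the indices that occur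
    in \<open>lower\<close>.\<close>
  moreover have "a i \<le> a (j - 1)" "a i' \<le> a (u - 1)" "c k \<le> c j" "c k' \<le> c u"
    using a c ju by (auto intro!: le)
  moreover have "2 * b j - c j - a (j - 1) + 2 * b u - c u - a (u - 1) > 0"
    using lower ju by auto
  ultimately show False by linarith
qed

text \<open>Mirror image of \<open>no_low_crossing\<close>: three downward sign changes contradict
  \<open>upper\<close>, taken at \<open>l\<close> and \<open>j\<close>.\<close>

lemma no_high_crossing:
  assumes F2: "F2 > 0" and sum0: "F1 + G1 + H1 = 0"
    and lj: "1 \<le> l" "l < j" "j < m"
    and a: "l \<le> i'" "i' < i" "j \<le> i" "i \<le> m"
      "0 \<le> F0 + F1 * a i' + F2 * (a i')\<^sup>2" "F0 + F1 * a i + F2 * (a i)\<^sup>2 \<le> 0"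
    and b: "0 \<le> G0 + G1 * b l + (-2 * F2) * (b l)\<^sup>2" "G0 + G1 * b j + (-2 * F2) * (b j)\<^sup>2 \<le> 0"
    and c: "l < k'" "k' < k" "j < k" "k \<le> m"
      "0 \<le> H0 + H1 * c k' + F2 * (c k')\<^sup>2" "H0 + H1 * c k + F2 * (c k)\<^sup>2 \<le> 0"
  shows False
proof -
  have "F1 + F2 * (a i' + a i) \<le> 0"
    by (rule quadratic_slope_nonpos[OF less(1) a(5,6)]) (use a lj in auto)
  moreover have "G1 + (-2 * F2) * (b l + b j) \<le> 0"
    by (rule quadratic_slope_nonpos[OF less(2) b]) (use lj in auto)
  moreover have "H1 + F2 * (c k' + c k) \<le> 0"
    by (rule quadratic_slope_nonpos[OF less(3) c(5,6)]) (use c lj in auto)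
  ultimately have "F2 * (a i' + a i + c k' + c k - 2 * b l - 2 * b j) \<le> 0"
    using sum0 by (simp add: algebra_simps)
  then have "a i' + a i + c k' + c k - 2 * b l - 2 * b j \<le> 0"
    using F2 by (simp add: mult_le_0_iff)
  moreover have "a j \<le> a i" "a l \<le> a i'" "c (j + 1) \<le> c k" "c (l + 1) \<le> c k'"
    using a c lj by (auto intro!: le)
  moreover have "c (l + 1) + a l - 2 * b l + c (j + 1) + a j - 2 * b j > 0"
    using upper lj by auto
  ultimately show False by linarith
qed

text \<open>For \<open>F2 > 0\<close>, \<open>f\<close> and \<open>h\<close> are strictly convex and
  \<open>g\<close> strictly concave. The pattern \<open>pos\<close> supplies \<open>l\<close> and
  \<open>u\<close> with points \<open>i'\<close>, \<open>k'\<close> between them; \<open>neg\<close>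
  supplies two chains. Concavity pushes the middle terms of the chains outside the interval from
  \<open>l\<close> to \<open>u\<close>, and each resulting position is refuted by a crossing lemma
  or by convexity.\<close>

lemma convex_separation:
  assumes F2: "F2 > 0" and sum0: "F1 + G1 + H1 = 0"
    and pos: "w0_pattern {i\<in>{1..m}. 0 \<le> F0 + F1 * a i + F2 * (a i)\<^sup>2}
      {i\<in>{1..m}. 0 \<le> G0 + G1 * b i + (-2 * F2) * (b i)\<^sup>2}
      {i\<in>{1..m}. 0 \<le> H0 + H1 * c i + F2 * (c i)\<^sup>2}"
    and neg: "w0_pattern {i\<in>{1..m}. F0 + F1 * a i + F2 * (a i)\<^sup>2 \<le> 0}
      {i\<in>{1..m}. G0 + G1 * b i + (-2 * F2) * (b i)\<^sup>2 \<le> 0}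
      {i\<in>{1..m}. H0 + H1 * c i + F2 * (c i)\<^sup>2 \<le> 0}"
  shows False
proof -
  define f where "f x = F0 + F1 * x + F2 * x\<^sup>2" for x
  define g where "g x = G0 + G1 * x + (-2 * F2) * x\<^sup>2" for x
  define h where "h x = H0 + H1 * x + F2 * x\<^sup>2" for x
  note defs = f_def g_def h_def
  obtain l u i' k' where p: "l \<in> {1..m}" "u \<in> {1..m}" "i' \<in> {1..m}" "k' \<in> {1..m}"
      "0 \<le> g (b l)" "0 \<le> g (b u)" "0 \<le> f (a i')" "0 \<le> h (c k')"
      "l \<le> i'" "i' < u" "l < k'" "k' \<le> u"
    using pos unfolding w0_pattern_def defs by blast
  obtain k1 j1 i1 where n1: "k1 \<in> {1..m}" "j1 \<in> {1..m}" "i1 \<in> {1..m}"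
      "h (c k1) \<le> 0" "g (b j1) \<le> 0" "f (a i1) \<le> 0" "k1 \<le> j1" "j1 \<le> i1"
    using neg unfolding w0_pattern_def defs by blast
  obtain i2 j2 k2 where n2: "k2 \<in> {1..m}" "j2 \<in> {1..m}" "i2 \<in> {1..m}"
      "h (c k2) \<le> 0" "g (b j2) \<le> 0" "f (a i2) \<le> 0" "i2 < j2" "j2 < k2"
    using neg unfolding w0_pattern_def defs by blast
  have outside: "j \<le> l \<or> u \<le> j" if "j \<in> {1..m}" "g (b j) \<le> 0" for j
  proof (rule ccontr)
    assume "\<not> ?thesis"
    then have "b l < b j" "b j < b u" using p that(1) by (auto intro: less)
    from quadratic_convex_neg[OF _ this, of "2 * F2" "-G0" "-G1"] p that F2
    show False unfolding g_def by (simp add: algebra_simps)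
  qed
  have f_convex: False if "i \<in> {1..m}" "k \<in> {1..m}" "i < j" "j < k" "f (a i) \<le> 0" "f (a k) \<le> 0" "0 \<le> f (a j)" for i j k
    using quadratic_convex_neg[OF F2 less(1) less(1), of i j k F0 F1] that unfolding f_def by auto
  have h_convex: False if "i \<in> {1..m}" "k \<in> {1..m}" "i < j" "j < k" "h (c i) \<le> 0" "h (c k) \<le> 0" "0 \<le> h (c j)" for i j k
    using quadratic_convex_neg[OF F2 less(3) less(3), of i j k H0 H1] that unfolding h_def by auto
  have low: False if "j \<in> {1..m}" "i \<in> {1..m}" "k \<in> {1..m}" "g (b j) \<le> 0" "f (a i) \<le> 0" "h (c k) \<le> 0"
      "j \<le> l" "i < j" "k \<le> j" for i j k
    by (rule no_low_crossing[OF F2 sum0, of j u i i' F0 G0 k k' H0])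
      (use p that in \<open>auto simp: defs\<close>)
  have high: False if "j \<in> {1..m}" "i \<in> {1..m}" "k \<in> {1..m}" "g (b j) \<le> 0" "f (a i) \<le> 0" "h (c k) \<le> 0"
      "u \<le> j" "j \<le> i" "j < k" for i j k
    by (rule no_high_crossing[OF F2 sum0, of l j i' i F0 G0 k' k H0])
      (use p that in \<open>auto simp: defs\<close>)
  show False
  proof (cases "j1 \<le> l")
    case True
    \<comment> \<open>Now \<open>k1 \<le> j1 \<le> i2 < j2 < k2\<close>. If
      \<open>j2 \<le> l\<close>, then \<open>low\<close> applies at \<open>j2\<close>; if
      \<open>u \<le> j2\<close>, then \<open>k'\<close> lies strictly between \<open>k1\<close> and
      \<open>k2\<close>, against convexity of \<open>h\<close>.\<close>
    then have "j1 \<le> i2" using low[of j1 i2 k1] n1 n2 by force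
    moreover have "j2 \<le> l \<or> u \<le> j2" using outside n2 by blast
    ultimately show False
      using low[of j2 i2 k1] h_convex[of k1 k2 k'] n1 n2 p True by force
  next
    case False
    then have u: "u \<le> j1" using outside n1 by blast
    \<comment> \<open>Now \<open>i2 < j2 < k2 \<le> j1 \<le> i1\<close>. If
      \<open>u \<le> j2\<close>, then \<open>high\<close> applies at \<open>j2\<close>; if
      \<open>j2 \<le> l\<close>, then \<open>i'\<close> lies strictly between \<open>i2\<close> and
      \<open>i1\<close>, against convexity of \<open>f\<close>.\<close>
    then have "k2 \<le> j1" using high[of j1 i1 k2] n1 n2 by force
    moreover have "j2 \<le> l \<or> u \<le> j2" using outside n2 by blast
    ultimately show False
      using high[of j2 i1 k2] f_convex[of i2 i1 i'] n1 n2 p u by force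
  qed
qed


text \<open>A nonzero slope orders the indices of nonpositive and of nonnegative values. If two
  slopes had opposite signs, a chain from \<open>pos\<close> and one from \<open>neg\<close> would
  close up to a cycle with a strict step, such as
  \<open>i2 < j2 < k2 \<le> k3 \<le> j3 \<le> i3 \<le> i2\<close>.\<close>

lemma linear_separation:
  assumes sum0: "F1 + G1 + H1 = 0"
    and pos: "w0_pattern {i\<in>{1..m}. 0 \<le> F0 + F1 * a i} {i\<in>{1..m}. 0 \<le> G0 + G1 * b i}
      {i\<in>{1..m}. 0 \<le> H0 + H1 * c i}"
    and neg: "w0_pattern {i\<in>{1..m}. F0 + F1 * a i \<le> 0} {i\<in>{1..m}. G0 + G1 * b i \<le> 0}
      {i\<in>{1..m}. H0 + H1 * c i \<le> 0}"
  shows "F0 = 0 \<and> F1 = 0 \<and> G0 = 0 \<and> G1 = 0 \<and> H0 = 0 \<and> H1 = 0"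
proof -
  have linear_less: "p1 > 0 \<Longrightarrow> p0 + p1 * x \<le> 0 \<Longrightarrow> 0 \<le> p0 + p1 * y \<Longrightarrow> \<not> y < x"
    "p1 < 0 \<Longrightarrow> p0 + p1 * x \<le> 0 \<Longrightarrow> 0 \<le> p0 + p1 * y \<Longrightarrow> \<not> x < y" for p0 p1 x y :: real
    using mult_strict_left_mono[of y x p1] mult_strict_left_mono_neg[of x y p1] by linarith+
  have index_le: "i \<le> i'" if "p1 > 0" "p0 + p1 * z i \<le> 0" "0 \<le> p0 + p1 * z i'" "i \<in> {1..m}" "i' \<in> {1..m}"
      "z = a \<or> z = b \<or> z = c" for p0 p1 i i' z
    using linear_less(1)[OF that(1-3)] less[of i' i] that(4-6) by (force simp: not_less[symmetric])
  have index_ge: "i' \<le> i" if "p1 < 0" "p0 + p1 * z i \<le> 0" "0 \<le> p0 + p1 * z i'" "i \<in> {1..m}" "i' \<in> {1..m}"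
      "z = a \<or> z = b \<or> z = c" for p0 p1 i i' z
    using linear_less(2)[OF that(1-3)] less[of i i'] that(4-6) by (force simp: not_less[symmetric])
  obtain k1 j1 i1 where p1: "k1 \<in> {1..m}" "j1 \<in> {1..m}" "i1 \<in> {1..m}" "0 \<le> H0 + H1 * c k1"
      "0 \<le> G0 + G1 * b j1" "0 \<le> F0 + F1 * a i1" "k1 \<le> j1" "j1 \<le> i1"
    using pos unfolding w0_pattern_def by blast
  obtain k2 j2 i2 where p2: "k2 \<in> {1..m}" "j2 \<in> {1..m}" "i2 \<in> {1..m}" "0 \<le> H0 + H1 * c k2"
      "0 \<le> G0 + G1 * b j2" "0 \<le> F0 + F1 * a i2" "i2 < j2" "j2 < k2"
    using pos unfolding w0_pattern_def by blast
  obtain k3 j3 i3 where n1: "k3 \<in> {1..m}" "j3 \<in> {1..m}" "i3 \<in> {1..m}" "H0 + H1 * c k3 \<le> 0"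
      "G0 + G1 * b j3 \<le> 0" "F0 + F1 * a i3 \<le> 0" "k3 \<le> j3" "j3 \<le> i3"
    using neg unfolding w0_pattern_def by blast
  obtain k4 j4 i4 where n2: "k4 \<in> {1..m}" "j4 \<in> {1..m}" "i4 \<in> {1..m}" "H0 + H1 * c k4 \<le> 0"
      "G0 + G1 * b j4 \<le> 0" "F0 + F1 * a i4 \<le> 0" "i4 < j4" "j4 < k4"
    using neg unfolding w0_pattern_def by blast
  have "\<not> (F1 > 0 \<and> H1 < 0)"
    using index_le[of F1 F0 a i3 i2] index_ge[of H1 H0 c k3 k2] p2 n1 by force
  moreover have "\<not> (F1 < 0 \<and> H1 > 0)"
    using index_ge[of F1 F0 a i4 i1] index_le[of H1 H0 c k4 k1] p1 n2 by force
  moreover have "\<not> (G1 > 0 \<and> F1 < 0)"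
    using index_ge[of F1 F0 a i4 i1] index_le[of G1 G0 b j4 j1] p1 n2 by force
  moreover have "\<not> (G1 < 0 \<and> F1 > 0)"
    using index_le[of F1 F0 a i3 i2] index_ge[of G1 G0 b j3 j2] p2 n1 by force
  moreover have "\<not> (G1 > 0 \<and> H1 < 0)"
    using index_ge[of H1 H0 c k3 k2] index_le[of G1 G0 b j3 j2] p2 n1 by force
  moreover have "\<not> (G1 < 0 \<and> H1 > 0)"
    using index_le[of H1 H0 c k4 k1] index_ge[of G1 G0 b j4 j1] p1 n2 by force
  \<comment> \<open>Three numbers with sum zero, no two of opposite sign, all vanish; the constants
    are then both nonnegative and nonpositive.\<close>
  ultimately have "F1 = 0" "G1 = 0" "H1 = 0" using sum0 by linarith+
  then show ?thesis using p1 n1 by simp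
qed

theorem separation:
  assumes sum0: "F1 + G1 + H1 = 0"
    and pos: "w0_pattern {i\<in>{1..m}. 0 \<le> F0 + F1 * a i + F2 * (a i)\<^sup>2}
      {i\<in>{1..m}. 0 \<le> G0 + G1 * b i + (-2 * F2) * (b i)\<^sup>2}
      {i\<in>{1..m}. 0 \<le> H0 + H1 * c i + F2 * (c i)\<^sup>2}"
    and neg: "w0_pattern {i\<in>{1..m}. F0 + F1 * a i + F2 * (a i)\<^sup>2 \<le> 0}
      {i\<in>{1..m}. G0 + G1 * b i + (-2 * F2) * (b i)\<^sup>2 \<le> 0}
      {i\<in>{1..m}. H0 + H1 * c i + F2 * (c i)\<^sup>2 \<le> 0}"
  shows "F0 = 0 \<and> F1 = 0 \<and> F2 = 0 \<and> G0 = 0 \<and> G1 = 0 \<and> H0 = 0 \<and> H1 = 0"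
proof (cases "F2 = 0")
  case True
  then show ?thesis using linear_separation[OF sum0, of F0 G0 H0] pos neg by simp
next
  case False
  have minus: "0 \<le> - p0 + - p1 * x + - p2 * x\<^sup>2 \<longleftrightarrow> p0 + p1 * x + p2 * x\<^sup>2 \<le> 0"
    "- p0 + - p1 * x + - p2 * x\<^sup>2 \<le> 0 \<longleftrightarrow> 0 \<le> p0 + p1 * x + p2 * x\<^sup>2" for p0 p1 p2 x :: real
    by auto
  have mF: "-2 * - F2 = - (-2 * F2)" by simp
  \<comment> \<open>Negating all coefficients exchanges \<open>pos\<close> and \<open>neg\<close>,
    which reduces a concave \<open>f\<close> to a convex one.\<close>
  have "F2 > 0 \<or> - F2 > 0" using False by auto
  then show ?thesis
  proof
    assume "F2 > 0"
    from convex_separation[OF this sum0 pos neg] show ?thesis ..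
  next
    assume "- F2 > 0"
    moreover have "- F1 + - G1 + - H1 = 0" using sum0 by simp
    ultimately show ?thesis
      using convex_separation[of "-F2" "-F1" "-G1" "-H1" "-F0" "-G0" "-H0"] pos neg
      unfolding mF minus by blast
  qed
qed

end

section \<open>Complete fans from sign separation\<close>

lemma square_system_solvable:
  fixes A :: "real mat"
  assumes A: "A \<in> carrier_mat n n"
    and inj: "\<And>v. v \<in> carrier_vec n \<Longrightarrow> A *\<^sub>v v = 0\<^sub>v n \<Longrightarrow> v = 0\<^sub>v n"
    and t: "t \<in> carrier_vec n"
  shows "\<exists>v\<in>carrier_vec n. A *\<^sub>v v = t"
proof -
  have "det A \<noteq> 0" using det_0_iff_vec_prod_zero_field[OF A] inj by blast
  from det_non_zero_imp_unit[OF A this, unfolded Units_def, of "()"]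
  obtain B where B: "B \<in> carrier_mat n n" "A * B = 1\<^sub>m n" by (auto simp: ring_mat_def)
  have "A *\<^sub>v (B *\<^sub>v t) = t"
    using assoc_mult_mat_vec[OF A B(1) t] B(2) t by simp
  then show ?thesis using B(1) t by (intro bexI[of _ "B *\<^sub>v t"]) auto
qed

text \<open>\<open>Fs\<close> stands for the complements of the facets. A vector \<open>v\<close>
  encodes the row-space element with entries \<open>col D j \<bullet> v\<close>, so
  \<open>separated\<close> is the sign property and \<open>exchange\<close> the absence of boundary
  walls.\<close>

locale sign_separated =
  fixes d n :: nat and D :: "real mat" and Fs :: "nat set set"
  assumes D: "D \<in> carrier_mat d n"
    and Fs_nonempty: "Fs \<noteq> {}"
    and Fs_subset: "P \<in> Fs \<Longrightarrow> P \<subseteq> {..<n}"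
    and Fs_card: "P \<in> Fs \<Longrightarrow> card P = d"
    and separated: "\<lbrakk>v \<in> carrier_vec d; P \<in> Fs; P' \<in> Fs; \<And>j. j \<in> P \<Longrightarrow> 0 \<le> col D j \<bullet> v;
      \<And>j. j \<in> P' \<Longrightarrow> col D j \<bullet> v \<le> 0\<rbrakk> \<Longrightarrow> v = 0\<^sub>v d"
    and exchange: "\<lbrakk>P \<in> Fs; i < n; i \<notin> P\<rbrakk> \<Longrightarrow> \<exists>j\<in>P. insert i P - {j} \<in> Fs"
begin

section \<open>Dual bases and pivoting\<close>

lemma finite_P: "P \<in> Fs \<Longrightarrow> finite P"
  using Fs_subset finite_subset by blast

lemma finite_Fs: "finite Fs"
  by (rule finite_subset[of _ "Pow {..<n}"]) (use Fs_subset in auto)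

lemma col_carrier [simp]: "col D j \<in> carrier_vec d"
  using D by auto

text \<open>The case \<open>P' = P\<close> of the sign property: a row-space element that vanishes
  on \<open>P\<close> is zero, so the \<open>d\<close> columns in \<open>P\<close> form an
  invertible matrix.\<close>

lemma interpolation:
  assumes P: "P \<in> Fs"
  shows "\<exists>v\<in>carrier_vec d. \<forall>j\<in>P. col D j \<bullet> v = t j"
proof -
  define ps where "ps = sorted_list_of_set P"
  have ps: "length ps = d" "set ps = P" "distinct ps"
    using Fs_card[OF P] finite_P[OF P] by (auto simp: ps_def)
  define A where "A = mat_of_rows d (map (col D) ps)"
  have A: "A \<in> carrier_mat d d" using ps by (simp add: A_def mat_of_rows_def)
  have rowA: "row A k = col D (ps ! k)" if "k < d" for k
    unfolding A_def using that ps by (subst mat_of_rows_row) auto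
  have "\<exists>v\<in>carrier_vec d. A *\<^sub>v v = vec d (\<lambda>k. t (ps ! k))"
  proof (rule square_system_solvable[OF A])
    fix v assume v: "v \<in> carrier_vec d" "A *\<^sub>v v = 0\<^sub>v d"
    have "col D j \<bullet> v = 0" if j: "j \<in> P" for j
    proof -
      obtain k where k: "k < d" "j = ps ! k" using j ps by (metis in_set_conv_nth)
      have "(A *\<^sub>v v) $ k = 0" using v k by simp
      then show ?thesis using k A rowA by simp
    qed
    then show "v = 0\<^sub>v d" using separated[OF v(1) P P] by simp
  qed simp
  then obtain v where v: "v \<in> carrier_vec d" "A *\<^sub>v v = vec d (\<lambda>k. t (ps ! k))" by blast
  have "col D j \<bullet> v = t j" if j: "j \<in> P" for j
  proof -
    obtain k where k: "k < d" "j = ps ! k" using j ps by (metis in_set_conv_nth)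
    have "(A *\<^sub>v v) $ k = t j" using v k by simp
    then show ?thesis using k A rowA by simp
  qed
  then show ?thesis using v(1) by blast
qed

definition dual :: "nat set \<Rightarrow> nat \<Rightarrow> real vec" where
  "dual P j = (SOME v. v \<in> carrier_vec d \<and> (\<forall>i\<in>P. col D i \<bullet> v = (if i = j then 1 else 0)))"

lemma dual:
  assumes "P \<in> Fs"
  shows "dual P j \<in> carrier_vec d" "i \<in> P \<Longrightarrow> col D i \<bullet> dual P j = (if i = j then 1 else 0)"
proof -
  have "\<exists>v. v \<in> carrier_vec d \<and> (\<forall>i\<in>P. col D i \<bullet> v = (if i = j then 1 else 0))"
    using interpolation[OF assms, of "\<lambda>i. if i = j then 1 else 0"] by blast
  from someI_ex[OF this, folded dual_def]
  show "dual P j \<in> carrier_vec d" "i \<in> P \<Longrightarrow> col D i \<bullet> dual P j = (if i = j then 1 else 0)"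
    by auto
qed

text \<open>\<open>slack P X\<close> is the element of \<open>X + row space of D\<close> that vanishes on \<open>P\<close>.\<close>

definition slack :: "nat set \<Rightarrow> (nat \<Rightarrow> real) \<Rightarrow> nat \<Rightarrow> real" where
  "slack P X i = X i - (\<Sum>j\<in>P. X j * (col D i \<bullet> dual P j))"

lemma slack_zero: "P \<in> Fs \<Longrightarrow> i \<in> P \<Longrightarrow> slack P X i = 0"
  using finite_P[of P] by (simp add: slack_def dual if_distrib cong: if_cong)

lemma slack_add_scaled: "slack P (\<lambda>j. X j + t * Y j) i = slack P X i + t * slack P Y i"
  by (simp add: slack_def algebra_simps sum.distrib sum_distrib_left)

lemma slack_eq_translate:
  assumes "P \<in> Fs"
  shows "\<exists>v\<in>carrier_vec d. \<forall>i. slack P X i = X i + col D i \<bullet> v"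
proof -
  have "\<exists>v\<in>carrier_vec d. \<forall>i. (\<Sum>j\<in>S. X j * (col D i \<bullet> dual P j)) = col D i \<bullet> v" if "finite S" for S
    using that
  proof induction
    case empty
    then show ?case by (intro bexI[of _ "0\<^sub>v d"]) auto
  next
    case (insert x S)
    then obtain v where "v \<in> carrier_vec d" "\<forall>i. (\<Sum>j\<in>S. X j * (col D i \<bullet> dual P j)) = col D i \<bullet> v"
      by blast
    then show ?case using insert.hyps dual(1)[OF assms]
      by (intro bexI[of _ "X x \<cdot>\<^sub>v dual P x + v"])
        (auto simp: scalar_prod_add_distrib[where n = d] scalar_prod_smult_distrib[where n = d])
  qed
  from this[OF finite_P[OF assms]] obtain v where v: "v \<in> carrier_vec d"
    "\<forall>i. (\<Sum>j\<in>P. X j * (col D i \<bullet> dual P j)) = col D i \<bullet> v" by blast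
  then show ?thesis
    by (intro bexI[of _ "(- 1) \<cdot>\<^sub>v v"]) (auto simp: slack_def scalar_prod_smult_distrib[where n = d])
qed

text \<open>The simplex pivot rule. The difference of the two sides is the row-space element of
  \<open>z\<close>, and it vanishes on the new set: at \<open>i\<close> the dual vector pairs to 1,
  at the remaining positions everything is 0.\<close>

lemma slack_pivot:
  assumes P: "P \<in> Fs" and P': "insert i P - {j} \<in> Fs" and i: "i \<notin> P" and j: "j \<in> P"
  shows "slack (insert i P - {j}) X k = slack P X k - slack P X i * (col D k \<bullet> dual (insert i P - {j}) i)"
proof -
  let ?P' = "insert i P - {j}" and ?w = "dual (insert i P - {j}) i"
  obtain v where v: "v \<in> carrier_vec d" "\<And>k. slack P X k = X k + col D k \<bullet> v"
    using slack_eq_translate[OF P] by blast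
  obtain v' where v': "v' \<in> carrier_vec d" "\<And>k. slack ?P' X k = X k + col D k \<bullet> v'"
    using slack_eq_translate[OF P'] by blast
  note w = dual[OF P', where j = i]
  define z where "z = v + ((- slack P X i) \<cdot>\<^sub>v ?w + (- 1) \<cdot>\<^sub>v v')"
  have z: "z \<in> carrier_vec d" using v v' w by (simp add: z_def)
  have eq: "col D k \<bullet> z = slack P X k - slack P X i * (col D k \<bullet> ?w) - slack ?P' X k" for k
    using v v' w(1) unfolding z_def
    by (simp add: scalar_prod_add_distrib[where n = d] scalar_prod_smult_distrib[where n = d]
        algebra_simps)
  have "col D k \<bullet> z = 0" if k: "k \<in> ?P'" for k
    using slack_zero[OF P' k] slack_zero[OF P, of k] w(2)[of k] k unfolding eq by auto
  then have "z = 0\<^sub>v d" using separated[OF z P' P'] by simp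
  then have "col D k \<bullet> z = 0" by simp
  then show ?thesis unfolding eq by simp
qed

text \<open>Otherwise the dual vector at \<open>i\<close> would be nonnegative on the new set and
  nonpositive on \<open>P\<close>, hence zero, although it pairs to 1 with column
  \<open>i\<close>.\<close>

lemma pivot_pos:
  assumes P: "P \<in> Fs" and P': "insert i P - {j} \<in> Fs" and i: "i \<notin> P" and j: "j \<in> P"
  shows "0 < col D j \<bullet> dual (insert i P - {j}) i"
proof (rule ccontr)
  let ?P' = "insert i P - {j}" and ?w = "dual (insert i P - {j}) i"
  note w = dual[OF P', where j = i]
  assume neg: "\<not> 0 < col D j \<bullet> ?w"
  have "?w = 0\<^sub>v d"
  proof (rule separated[OF w(1) P' P])
    show "0 \<le> col D k \<bullet> ?w" if "k \<in> ?P'" for k using w(2)[of k] that by auto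
    show "col D k \<bullet> ?w \<le> 0" if "k \<in> P" for k
      using w(2)[of k] neg that i by (cases "k = j") auto
  qed
  moreover have "i \<in> ?P'" using i j by auto
  ultimately show False using w(2)[of i] by simp
qed

section \<open>Completeness by walking along lines\<close>

definition covered :: "(nat \<Rightarrow> real) \<Rightarrow> bool" where
  "covered X \<longleftrightarrow> (\<exists>P\<in>Fs. \<forall>i<n. 0 \<le> slack P X i)"

text \<open>\<open>slack P X\<close> is the only representative of \<open>X\<close> modulo the row
  space that vanishes on \<open>P\<close>, so \<open>covered\<close> means membership in some cone.
  Closedness lets the walk reach its limit points.\<close>

lemma closed_covered_line: "closed {t. covered (\<lambda>j. Y j + t * e j)}"
proof -
  have "{t. covered (\<lambda>j. Y j + t * e j)} =
      (\<Union>P\<in>Fs. \<Inter>i\<in>{..<n}. {t. 0 \<le> slack P Y i + t * slack P e i})"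
    by (auto simp: covered_def slack_add_scaled)
  moreover have "closed {t. 0 \<le> slack P Y i + t * slack P e i}" for P i
    by (intro closed_Collect_le continuous_intros)
  ultimately show ?thesis using finite_Fs by (auto intro!: closed_UN closed_INT)
qed

text \<open>Crossing a wall: by \<open>pivot_pos\<close> the facet obtained by the exchange lies on the other
  side.\<close>

lemma covered_continues:
  assumes cov: "covered (\<lambda>j. Y j + t * e j)"
    and generic: "\<And>P i k. \<lbrakk>P \<in> Fs; i < n; k < n; i \<notin> P; k \<notin> P; i \<noteq> k;
      slack P Y i + t * slack P e i = 0\<rbrakk> \<Longrightarrow> slack P Y k + t * slack P e k \<noteq> 0"
  shows "\<forall>\<^sub>F t' in at_left t. covered (\<lambda>j. Y j + t' * e j)"
proof -
  obtain P where P: "P \<in> Fs" and nonneg: "\<And>i. i < n \<Longrightarrow> 0 \<le> slack P Y i + t * slack P e i"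
    using cov by (auto simp: covered_def slack_add_scaled)
  have stays_pos: "\<forall>\<^sub>F t' in at_left t. 0 < slack P Y i + t' * slack P e i"
    if "0 < slack P Y i + t * slack P e i" for i P
  proof -
    have "((\<lambda>t'. slack P Y i + t' * slack P e i) \<longlongrightarrow> slack P Y i + t * slack P e i) (at_left t)"
      by (intro tendsto_intros)
    from order_tendstoD(1)[OF this that] show ?thesis .
  qed
  show ?thesis
  proof (cases "\<exists>i<n. i \<notin> P \<and> slack P Y i + t * slack P e i = 0")
    case False
    have "\<forall>\<^sub>F t' in at_left t. \<forall>i\<in>{i. i < n \<and> i \<notin> P}. 0 < slack P Y i + t' * slack P e i"
      by (rule eventually_ball_finite) (use False nonneg stays_pos in \<open>force simp: less_le\<close>)+
    then show ?thesis
    proof eventually_elim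
      case (elim t')
      have "0 \<le> slack P Y i + t' * slack P e i" if "i < n" for i
        using elim that slack_zero[OF P, of i] by (cases "i \<in> P") (auto intro: less_imp_le)
      then show ?case using P by (auto simp: covered_def slack_add_scaled)
    qed
  next
    case True
    then obtain i where i: "i < n" "i \<notin> P" "slack P Y i + t * slack P e i = 0" by blast
    \<comment> \<open>By genericity the point lies on the single wall \<open>i\<close>; all other
      slacks off \<open>P\<close> are positive and stay so. The sign of the slope at
      \<open>i\<close> decides whether the line stays in this cone to the left of
      \<open>t\<close>.\<close>
    have "\<forall>\<^sub>F t' in at_left t. \<forall>k\<in>{k. k < n \<and> k \<notin> P \<and> k \<noteq> i}. 0 < slack P Y k + t' * slack P e k"
    proof (rule eventually_ball_finite)
      show "\<forall>k\<in>{k. k < n \<and> k \<notin> P \<and> k \<noteq> i}. \<forall>\<^sub>F t' in at_left t. 0 < slack P Y k + t' * slack P e k"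
        using generic[OF P i(1) _ i(2) _ _ i(3)] nonneg stays_pos by (force simp: less_le)
    qed simp
    moreover have "\<forall>\<^sub>F t' in at_left t. t' < t" by (simp add: eventually_at_filter)
    ultimately show ?thesis
    proof (cases "slack P e i \<le> 0")
      case slope: True
      from \<open>\<forall>\<^sub>F t' in at_left t. \<forall>k\<in>_. _\<close> \<open>\<forall>\<^sub>F t' in at_left t. t' < t\<close> show ?thesis
      proof eventually_elim
        case (elim t')
        have "0 \<le> (t' - t) * slack P e i" using elim slope by (simp add: mult_nonpos_nonpos)
        then have "0 \<le> slack P Y i + t' * slack P e i" using i(3) by (simp add: algebra_simps)
        then have "0 \<le> slack P Y k + t' * slack P e k" if "k < n" for k
          using elim that slack_zero[OF P, of k] by (cases "k \<in> P"; cases "k = i") (auto intro: less_imp_le)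
        then show ?case using P by (auto simp: covered_def slack_add_scaled)
      qed
    next
      case slope: False
      obtain j where j: "j \<in> P" and P': "insert i P - {j} \<in> Fs" using exchange[OF P i(1,2)] by blast
      let ?P' = "insert i P - {j}" and ?w = "\<lambda>k. col D k \<bullet> dual (insert i P - {j}) i"
      note pivot = slack_pivot[OF P P' i(2) j]
      have "\<forall>\<^sub>F t' in at_left t. \<forall>k\<in>{k. k < n \<and> k \<notin> P \<and> k \<noteq> i}. 0 < slack ?P' Y k + t' * slack ?P' e k"
      proof (rule eventually_ball_finite)
        \<comment> \<open>The pivot changes every slack by a multiple of the slack at
          \<open>i\<close>, which is zero at \<open>t\<close>, so the old positive values
          persist.\<close>
        have "slack ?P' Y k + t * slack ?P' e k = slack P Y k + t * slack P e k -
            (slack P Y i + t * slack P e i) * ?w k" for k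
          unfolding pivot by (simp add: algebra_simps)
        then have "slack ?P' Y k + t * slack ?P' e k = slack P Y k + t * slack P e k" for k
          using i(3) by simp
        then show "\<forall>k\<in>{k. k < n \<and> k \<notin> P \<and> k \<noteq> i}. \<forall>\<^sub>F t' in at_left t. 0 < slack ?P' Y k + t' * slack ?P' e k"
          using generic[OF P i(1) _ i(2) _ _ i(3)] nonneg
          by (intro ballI stays_pos) (force simp: less_le)
      qed simp
      from this \<open>\<forall>\<^sub>F t' in at_left t. t' < t\<close> show ?thesis
      proof eventually_elim
        case (elim t')
        have "(t' - t) * slack P e i \<le> 0" using elim slope by (simp add: mult_nonpos_nonneg)
        then have le: "slack P Y i + t' * slack P e i \<le> 0" using i(3) by (simp add: algebra_simps)
        have "slack ?P' Y j + t' * slack ?P' e j = - (slack P Y i + t' * slack P e i) * ?w j"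
          unfolding pivot using slack_zero[OF P j] by (simp add: algebra_simps)
        then have "0 \<le> slack ?P' Y j + t' * slack ?P' e j"
          using le pivot_pos[OF P P' i(2) j] by (simp add: mult_nonpos_nonneg)
        then have "0 \<le> slack ?P' Y k + t' * slack ?P' e k" if "k < n" for k
          using elim that slack_zero[OF P', of k]
          by (cases "k \<in> ?P'"; cases "k = j") (auto intro: less_imp_le)
        then show ?case using P' by (auto simp: covered_def slack_add_scaled)
      qed
    qed
  qed
qed

text \<open>The direction \<open>e\<close> points into the interior of the cone of
  \<open>P0\<close>, so large \<open>t\<close> are covered. The infimum of those \<open>t\<close>
  from which on everything is covered is itself good by closedness; were it positive,
  \<open>covered_continues\<close> would push it further left.\<close>

lemma covered_if_generic:
  assumes P0: "P0 \<in> Fs" and e: "e = (\<lambda>j. if j \<in> P0 then 0 else 1)"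
    and generic: "\<And>t P i k. \<lbrakk>P \<in> Fs; i < n; k < n; i \<notin> P; k \<notin> P; i \<noteq> k;
      slack P Y i + t * slack P e i = 0\<rbrakk> \<Longrightarrow> slack P Y k + t * slack P e k \<noteq> 0"
  shows "covered Y"
proof -
  define good where "good t \<longleftrightarrow> covered (\<lambda>j. Y j + t * e j)" for t
  define S where "S = {t. 0 \<le> t \<and> (\<forall>t'\<ge>t. good t')}"
  have se: "slack P0 e i = (if i \<in> P0 then 0 else 1)" for i
    by (simp add: slack_def e)
  \<comment> \<open>A crude bound: beyond it \<open>t\<close> outweighs every negative slack off
    \<open>P0\<close>, where \<open>slack P0 e\<close> is 1.\<close>
  define t0 where "t0 = (\<Sum>i<n. \<bar>slack P0 Y i\<bar>)"
  have "good t" if "t \<ge> t0" for t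
  proof -
    have "0 \<le> slack P0 Y i + t * slack P0 e i" if "i < n" for i
    proof -
      have "\<bar>slack P0 Y i\<bar> \<le> t0" unfolding t0_def using that by (intro member_le_sum) auto
      then show ?thesis using \<open>t \<ge> t0\<close> slack_zero[OF P0, of i] unfolding se by auto
    qed
    then show ?thesis unfolding good_def covered_def slack_add_scaled using P0 by blast
  qed
  moreover have "0 \<le> t0" by (simp add: t0_def sum_nonneg)
  ultimately have "t0 \<in> S" by (auto simp: S_def)
  have bdd: "bdd_below S" by (rule bdd_belowI[of _ 0]) (simp add: S_def)
  define t where "t = Inf S"
  have t_nonneg: "0 \<le> t" unfolding t_def using \<open>t0 \<in> S\<close> by (intro cInf_greatest) (auto simp: S_def)
  have above: "good t'" if "t' > t" for t'
    using cInf_lessD[of S t'] that \<open>t0 \<in> S\<close> unfolding t_def by (force simp: S_def)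
  have "good t"
  proof (rule ccontr)
    assume "\<not> good t"
    moreover have "open (- {t. good t})" using closed_covered_line by (simp add: good_def open_Compl)
    ultimately obtain r where r: "r > 0" "\<And>t'. dist t' t < r \<Longrightarrow> \<not> good t'"
      by (auto simp: open_dist)
    moreover have "dist (t + r / 2) t < r" using r(1) by (simp add: dist_real_def)
    ultimately show False using above[of "t + r / 2"] by auto
  qed
  have "t = 0"
  proof (rule ccontr)
    assume "t \<noteq> 0"
    then have "t > 0" using t_nonneg by simp
    have "\<forall>\<^sub>F t' in at_left t. good t'"
      unfolding good_def by (rule covered_continues) (use \<open>good t\<close> generic in \<open>auto simp: good_def\<close>)
    then obtain r where r: "r < t" "\<And>t'. r < t' \<Longrightarrow> t' < t \<Longrightarrow> good t'"
      using \<open>t > 0\<close> by (auto simp: eventually_at_left[of 0])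
    \<comment> \<open>The midpoint of \<open>max r 0\<close> and \<open>t\<close> lies in
      \<open>S\<close> strictly below its infimum.\<close>
    define r' where "r' = (max r 0 + t) / 2"
    have r': "r < r'" "0 \<le> r'" "r' < t" using r(1) \<open>t > 0\<close> by (auto simp: r'_def)
    have "r' \<in> S" using r' r(2) above \<open>good t\<close> unfolding S_def
      by (auto simp: not_less) (metis less_le_trans linorder_less_linear order_less_le)
    then have "t \<le> r'" unfolding t_def using bdd by (rule cInf_lower)
    then show False using r' by simp
  qed
  then show ?thesis using \<open>good t\<close> by (simp add: good_def)
qed


text \<open>Perturbing along the moment curve turns the genericity conditions into the nonvanishing
  of finitely many nonzero polynomials.\<close>

definition perturbed_slack :: "nat set \<Rightarrow> (nat \<Rightarrow> real) \<Rightarrow> nat \<Rightarrow> real poly" where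
  "perturbed_slack P Y i = [:slack P Y i:] + monom 1 (i + 1) - (\<Sum>j\<in>P. monom (col D i \<bullet> dual P j) (j + 1))"

lemma poly_perturbed_slack:
  "poly (perturbed_slack P Y i) \<delta> = slack P (\<lambda>j. Y j + 1 * \<delta> ^ (j + 1)) i"
  unfolding slack_add_scaled perturbed_slack_def
  by (simp add: slack_def poly_sum poly_monom algebra_simps)

text \<open>The exponents \<open>j + 1\<close> are distinct and positive, so off \<open>P\<close>
  the coefficient of degree \<open>k + 1\<close> can come only from the perturbation of the entry
  \<open>k\<close> itself; the unperturbed slack sits in degree 0.\<close>

lemma coeff_perturbed_slack:
  assumes "P \<in> Fs" "k \<notin> P"
  shows "coeff (perturbed_slack P Y i) (k + 1) = (if k = i then 1 else 0)"
proof -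
  have "(\<Sum>j\<in>P. if j = k then col D i \<bullet> dual P j else 0) = 0"
    using assms finite_P by (simp add: sum.delta)
  then show ?thesis by (simp add: perturbed_slack_def coeff_sum)
qed

text \<open>Being uncovered is an open condition: each \<open>P\<close> has a negative slack at
  \<open>Y\<close>, and it stays negative for small \<open>\<delta>\<close>. Avoiding finitely many
  roots makes the perturbed line generic, hence its starting point covered, a contradiction.\<close>

theorem covered: "covered Y"
proof (rule ccontr)
  assume "\<not> covered Y"
  obtain P0 where P0: "P0 \<in> Fs" using Fs_nonempty by blast
  define e :: "nat \<Rightarrow> real" where "e = (\<lambda>j. if j \<in> P0 then 0 else 1)"
  \<comment> \<open>The eliminant of \<open>t\<close> from the two equations saying that the slacks
    at \<open>i\<close> and \<open>k\<close> vanish. If both slopes are zero the equations do not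
    involve \<open>t\<close>, and the slack at \<open>i\<close> alone serves.\<close>
  define q where "q = (\<lambda>(P, i, k). if slack P e i = 0 \<and> slack P e k = 0 then perturbed_slack P Y i
    else Polynomial.smult (slack P e k) (perturbed_slack P Y i) - Polynomial.smult (slack P e i) (perturbed_slack P Y k))"
  define T where "T = {(P, i, k). P \<in> Fs \<and> i < n \<and> k < n \<and> i \<notin> P \<and> k \<notin> P \<and> i \<noteq> k}"
  have q_nonzero: "q x \<noteq> 0" if "x \<in> T" for x
  proof -
    obtain P i k where x: "x = (P, i, k)" by (cases x)
    have *: "P \<in> Fs" "i \<notin> P" "k \<notin> P" "i \<noteq> k" using that by (auto simp: T_def x)
    note c = coeff_perturbed_slack[OF *(1)]
    show ?thesis
    proof (cases "slack P e k = 0")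
      case False
      have "coeff (q x) (i + 1) = slack P e k"
        using False * unfolding q_def x by (simp only: prod.case if_False simp_thms coeff_diff coeff_smult c) simp
      then show ?thesis using False by auto
    next
      case k: True
      show ?thesis
      proof (cases "slack P e i = 0")
        case True
        have "coeff (q x) (i + 1) = 1"
          using True k * unfolding q_def x by (simp only: prod.case if_True simp_thms c)
        then show ?thesis by auto
      next
        case False
        have "coeff (q x) (k + 1) = - slack P e i"
          using False k * unfolding q_def x by (simp only: prod.case if_False simp_thms coeff_diff coeff_smult c) simp
        then show ?thesis using False by auto
      qed
    qed
  qed
  have "finite T"
    by (rule finite_subset[of _ "Fs \<times> {..<n} \<times> {..<n}"]) (auto simp: T_def finite_Fs)
  then have finite_roots: "finite (\<Union>x\<in>T. {\<delta>. poly (q x) \<delta> = 0})"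
    using q_nonzero poly_roots_finite by blast
  have "\<forall>\<^sub>F \<delta> in at_right 0. \<forall>P\<in>Fs. \<exists>i<n. slack P (\<lambda>j. Y j + 1 * \<delta> ^ (j + 1)) i < 0"
  proof (rule eventually_ball_finite[OF finite_Fs], rule ballI)
    fix P assume "P \<in> Fs"
    then obtain i where i: "i < n" "slack P Y i < 0"
      using \<open>\<not> covered Y\<close> by (auto simp: covered_def not_le)
    have "((\<lambda>\<delta>. poly (perturbed_slack P Y i) \<delta>) \<longlongrightarrow> poly (perturbed_slack P Y i) 0) (at_right 0)"
      by (intro tendsto_intros)
    moreover have "poly (perturbed_slack P Y i) 0 < 0"
      using i(2) by (simp add: perturbed_slack_def poly_sum poly_monom)
    ultimately have "\<forall>\<^sub>F \<delta> in at_right 0. poly (perturbed_slack P Y i) \<delta> < 0"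
      by (rule order_tendstoD(2))
    then show "\<forall>\<^sub>F \<delta> in at_right 0. \<exists>i<n. slack P (\<lambda>j. Y j + 1 * \<delta> ^ (j + 1)) i < 0"
      unfolding poly_perturbed_slack by eventually_elim (use i(1) in blast)
  qed
  then obtain r where r: "r > 0"
    "\<And>\<delta> P. 0 < \<delta> \<Longrightarrow> \<delta> < r \<Longrightarrow> P \<in> Fs \<Longrightarrow> \<exists>i<n. slack P (\<lambda>j. Y j + 1 * \<delta> ^ (j + 1)) i < 0"
    by (auto simp: eventually_at_right[of 0 1])
  have "infinite ({0<..<r} - (\<Union>x\<in>T. {\<delta>. poly (q x) \<delta> = 0}))"
    using finite_roots infinite_Ioo[OF r(1)] by (rule Diff_infinite_finite)
  then have "{0<..<r} - (\<Union>x\<in>T. {\<delta>. poly (q x) \<delta> = 0}) \<noteq> {}"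
    by (rule infinite_imp_nonempty)
  then obtain \<delta> where "\<delta> \<in> {0<..<r} - (\<Union>x\<in>T. {\<delta>. poly (q x) \<delta> = 0})"
    by (rule ex_in_conv[THEN iffD2, THEN exE])
  then have \<delta>: "0 < \<delta>" "\<delta> < r" "\<And>x. x \<in> T \<Longrightarrow> poly (q x) \<delta> \<noteq> 0" by simp_all
  let ?Y = "\<lambda>j. Y j + 1 * \<delta> ^ (j + 1)"
  have "covered ?Y"
  proof (rule covered_if_generic[OF P0 e_def], rule notI)
    fix t P i k
    assume *: "P \<in> Fs" "i < n" "k < n" "i \<notin> P" "k \<notin> P" "i \<noteq> k"
      and zero: "slack P ?Y i + t * slack P e i = 0" "slack P ?Y k + t * slack P e k = 0"
    have "slack P ?Y i = - t * slack P e i" "slack P ?Y k = - t * slack P e k" using zero by auto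
    then have "poly (q (P, i, k)) \<delta> = 0"
      unfolding q_def by (simp add: poly_perturbed_slack[simplified])
    then show False using \<delta>(3)[of "(P, i, k)"] * by (simp add: T_def)
  qed
  then obtain P where "P \<in> Fs" "\<And>i. i < n \<Longrightarrow> 0 \<le> slack P ?Y i" by (auto simp: covered_def)
  then show False using r(2)[OF \<delta>(1,2)] by (meson not_le)
qed


subsection \<open>Gale duality\<close>

lemma row_space_pairing:
  assumes "v \<in> carrier_vec d" "x \<in> carrier_vec n"
  shows "(\<Sum>l<n. x $ l * (col D l \<bullet> v)) = v \<bullet> (D *\<^sub>v x)"
proof -
  have "v \<bullet> (D *\<^sub>v x) = (transpose_mat D *\<^sub>v v) \<bullet> x"
    using transpose_vec_mult_scalar[OF D assms(2,1)] by simp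
  also have "\<dots> = (\<Sum>l<n. x $ l * (col D l \<bullet> v))"
    using assms D by (auto simp: scalar_prod_def[of _ x] lessThan_atLeast0 intro!: sum.cong)
  finally show ?thesis by simp
qed

lemma mat_kernel_iff:
  assumes x: "x \<in> carrier_vec n"
  shows "x \<in> mat_kernel D \<longleftrightarrow> (\<forall>v\<in>carrier_vec d. (\<Sum>l<n. x $ l * (col D l \<bullet> v)) = 0)"
proof
  assume "x \<in> mat_kernel D"
  then show "\<forall>v\<in>carrier_vec d. (\<Sum>l<n. x $ l * (col D l \<bullet> v)) = 0"
    using mat_kernelD[OF D] row_space_pairing[OF _ x] by simp
next
  assume *: "\<forall>v\<in>carrier_vec d. (\<Sum>l<n. x $ l * (col D l \<bullet> v)) = 0"
  have "D *\<^sub>v x = 0\<^sub>v d"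
  proof (rule eq_vecI)
    fix k assume k: "k < dim_vec (0\<^sub>v d :: real vec)"
    have "D *\<^sub>v x \<in> carrier_vec d" using D x by simp
    then have "(D *\<^sub>v x) $ k = unit_vec d k \<bullet> (D *\<^sub>v x)" using k by simp
    also have "\<dots> = 0" using row_space_pairing[OF _ x, of "unit_vec d k"] * by simp
    finally show "(D *\<^sub>v x) $ k = 0\<^sub>v d $ k" using k by simp
  qed (use D in simp)
  then show "x \<in> mat_kernel D" using D x by (intro mat_kernelI)
qed

lemma row_space_eqI:
  assumes "P \<in> Fs" "v \<in> carrier_vec d" "\<And>j. j \<in> P \<Longrightarrow> col D j \<bullet> v = 0"
  shows "v = 0\<^sub>v d"
  using separated[OF assms(2,1,1)] assms(3) by simp

text \<open>For \<open>i\<close> outside \<open>P\<close>, the fundamental circuit of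
  \<open>i\<close>: the linear relation expressing column \<open>i\<close> through the columns in
  \<open>P\<close>.\<close>

definition kernel_vec :: "nat set \<Rightarrow> nat \<Rightarrow> real vec" where
  "kernel_vec P i = vec n (\<lambda>l. if l = i then 1 else if l \<in> P then - (col D i \<bullet> dual P l) else 0)"

lemma kernel_vec_pairing:
  assumes P: "P \<in> Fs" and i: "i < n" "i \<notin> P"
  shows "(\<Sum>l<n. kernel_vec P i $ l * X l) = slack P X i"
proof -
  have "(\<Sum>l<n. kernel_vec P i $ l * X l) =
      (\<Sum>l<n. (if l = i then X i else 0) - (if l \<in> P then X l * (col D i \<bullet> dual P l) else 0))"
    using i by (intro sum.cong) (auto simp: kernel_vec_def)
  also have "\<dots> = X i - (\<Sum>l\<in>{..<n} \<inter> P. X l * (col D i \<bullet> dual P l))"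
    using i by (simp add: sum_subtractf sum.inter_restrict)
  also have "{..<n} \<inter> P = P" using Fs_subset[OF P] by blast
  finally show ?thesis by (simp add: slack_def)
qed

text \<open>The slack of a row-space element is again one and vanishes on \<open>P\<close>.\<close>

lemma slack_row_space:
  assumes P: "P \<in> Fs" and v: "v \<in> carrier_vec d"
  shows "slack P (\<lambda>l. col D l \<bullet> v) i = 0"
proof -
  obtain v' where v': "v' \<in> carrier_vec d"
    "\<And>i. slack P (\<lambda>l. col D l \<bullet> v) i = col D i \<bullet> v + col D i \<bullet> v'"
    using slack_eq_translate[OF P] by blast
  then have eq: "slack P (\<lambda>l. col D l \<bullet> v) i = col D i \<bullet> (v + v')" for i
    using v by (simp add: scalar_prod_add_distrib[where n = d])
  have "v + v' = 0\<^sub>v d"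
    by (rule row_space_eqI[OF P]) (use v v'(1) slack_zero[OF P] in \<open>auto simp flip: eq\<close>)
  then show ?thesis unfolding eq by simp
qed

lemma kernel_vec_carrier [simp]: "kernel_vec P i \<in> carrier_vec n"
  by (simp add: kernel_vec_def)

lemma kernel_vec_in_kernel:
  assumes "P \<in> Fs" "i < n" "i \<notin> P"
  shows "kernel_vec P i \<in> mat_kernel D"
  unfolding mat_kernel_iff[OF kernel_vec_carrier]
  using kernel_vec_pairing[OF assms] slack_row_space[OF assms(1)] by simp

text \<open>Pairing a kernel vector supported on \<open>P\<close> with the row-space element of
  \<open>dual P j\<close> isolates its entry at \<open>j\<close>.\<close>

lemma kernel_eq_zero:
  assumes P: "P \<in> Fs" and x: "x \<in> mat_kernel D" and zero: "\<And>l. l < n \<Longrightarrow> l \<notin> P \<Longrightarrow> x $ l = 0"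
  shows "x = 0\<^sub>v n"
proof (rule eq_vecI)
  have xc: "x \<in> carrier_vec n" using mat_kernelD[OF D x] by simp
  then show "dim_vec x = dim_vec (0\<^sub>v n)" by simp
  fix j assume "j < dim_vec (0\<^sub>v n :: real vec)"
  then have j: "j < n" by simp
  show "x $ j = 0\<^sub>v n $ j"
  proof (cases "j \<in> P")
    case True
    have "0 = (\<Sum>l<n. x $ l * (col D l \<bullet> dual P j))"
      using x mat_kernel_iff[OF xc] dual(1)[OF P] by simp
    also have "\<dots> = (\<Sum>l<n. if l = j then x $ j else 0)"
      using zero dual(2)[OF P] by (intro sum.cong) force+
    finally show ?thesis using j by simp
  qed (use zero j in auto)
qed

interpretation K: kernel d n D
  by unfold_locales (rule D)

lemma kernel_vec_entries:
  assumes "i < n" "l < n" "l \<notin> P"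
  shows "kernel_vec P i $ l = (if l = i then 1 else 0)"
  using assms by (simp add: kernel_vec_def)

text \<open>The fundamental circuits of one \<open>P\<close> form a basis: off \<open>P\<close> they
  are unit vectors, which gives independence and the coefficients, and \<open>kernel_eq_zero\<close>
  gives spanning. This fixes the number of rows of every Gale dual.\<close>

lemma kernel_dim_eq: "K.dim = n - d"
proof -
  obtain P where P: "P \<in> Fs" using Fs_nonempty by blast
  define I where "I = {..<n} - P"
  have I: "finite I" "card I = n - d"
    using card_Diff_subset[OF finite_P[OF P] Fs_subset[OF P]] Fs_card[OF P] by (auto simp: I_def)
  have inj: "inj_on (kernel_vec P) I"
  proof (rule inj_onI)
    fix i j assume "i \<in> I" "j \<in> I" "kernel_vec P i = kernel_vec P j"
    then show "i = j" using kernel_vec_entries[of i i P] kernel_vec_entries[of j i P]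
      by (auto simp: I_def split: if_splits)
  qed
  let ?B = "kernel_vec P ` I"
  have B: "?B \<subseteq> mat_kernel D" using kernel_vec_in_kernel[OF P] by (auto simp: I_def)
  have entry: "K.lincomb a ?B $ l = a (kernel_vec P l)" if "l \<in> I" for a l
  proof -
    have "K.lincomb a ?B $ l = (\<Sum>i\<in>I. a (kernel_vec P i) * kernel_vec P i $ l)"
      using that by (subst K.lincomb_index[OF _ B]) (auto simp: I_def sum.reindex[OF inj[unfolded I_def]])
    also have "\<dots> = (\<Sum>i\<in>I. if i = l then a (kernel_vec P l) else 0)"
      using that by (intro sum.cong) (auto simp: kernel_vec_entries I_def)
    finally show ?thesis using that I by simp
  qed
  have indpt: "K.lin_indpt ?B"
  proof (rule K.Ker.finite_lin_indpt2)
    fix a assume "K.lincomb a ?B = 0\<^sub>v n"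
    then have "a (kernel_vec P l) = 0" if "l \<in> I" for l
      using entry[OF that, of a] that by (simp add: I_def)
    then show "\<forall>v\<in>?B. a v = 0" by simp
  qed (use I B in auto)
  have "mat_kernel D \<subseteq> K.span ?B"
  proof
    fix x assume x: "x \<in> mat_kernel D"
    define a where "a = (\<lambda>v. x $ (the_inv_into I (kernel_vec P) v))"
    have a: "a (kernel_vec P l) = x $ l" if "l \<in> I" for l
      using the_inv_into_f_f[OF inj that] by (simp add: a_def)
    let ?y = "K.lincomb a ?B"
    have y: "?y \<in> mat_kernel D" using B by (intro K.Ker.lincomb_closed) (auto simp: class_ring_simps)
    have xc: "x \<in> carrier_vec n" "?y \<in> carrier_vec n" using mat_kernelD[OF D] x y by auto
    have "x - ?y = 0\<^sub>v n"
    proof (rule kernel_eq_zero[OF P])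
      show "x - ?y \<in> mat_kernel D"
        using xc mat_kernelD[OF D x] mat_kernelD[OF D y] D
        by (intro mat_kernelI[OF D]) (auto simp: mult_minus_distrib_mat_vec[OF D])
      show "(x - ?y) $ l = 0" if "l < n" "l \<notin> P" for l
        using that xc entry[of l a] a[of l] by (simp add: I_def)
    qed
    have "x = ?y"
    proof (rule eq_vecI)
      fix l assume l: "l < dim_vec ?y"
      then have "(x - ?y) $ l = 0" unfolding \<open>x - ?y = 0\<^sub>v n\<close> using xc by simp
      then show "x $ l = ?y $ l" using l xc by simp
    qed (use xc in simp)
    moreover have "?y \<in> K.span ?B" unfolding K.Ker.span_def using I by (auto simp: class_ring_simps)
    ultimately show "x \<in> K.span ?B" by simp
  qed
  then have "K.span ?B = mat_kernel D"
    using K.Ker.span_is_subset2[OF B] by auto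
  then have "K.basis ?B" unfolding K.Ker.basis_def using indpt B by auto
  from K.Ker.dim_basis[OF _ this] I inj show ?thesis by (simp add: card_image)
qed

section \<open>Kernel and image of a Gale dual\<close>

context
  fixes M :: "real mat"
  assumes gale: "gale_dual D M"
begin

lemma gale_unfold: "dim_col M = n" "distinct (rows M)" "K.basis (set (rows M))"
proof -
  have "dim_col D = n" using D by simp
  note * = gale[unfolded gale_dual_def this]
  show "dim_col M = n" "distinct (rows M)" "K.basis (set (rows M))"
    by (rule *[THEN conjunct1], rule *[THEN conjunct2, THEN conjunct1],
        rule *[THEN conjunct2, THEN conjunct2])
qed

lemma dim_gale_dual: "M \<in> carrier_mat (n - d) n"
proof -
  have "card (set (rows M)) = n - d"
    using K.Ker.dim_basis[OF _ gale_unfold(3)] kernel_dim_eq by simp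
  then have "dim_row M = n - d" using distinct_card[OF gale_unfold(2)] by simp
  then show ?thesis using gale_unfold(1) by (rule carrier_matI)
qed

lemma rows_in_kernel: "set (rows M) \<subseteq> mat_kernel D"
  using gale_unfold(3) unfolding K.Ker.basis_def by simp

text \<open>Double orthogonality. If \<open>M\<close> kills \<open>x\<close>, then \<open>x\<close>
  is orthogonal to the kernel of \<open>D\<close>, in particular to the circuits, so its slack is
  zero everywhere and \<open>x\<close> is a row-space element. The converse holds because the rows
  of \<open>M\<close> lie in the kernel.\<close>

lemma gale_dual_kernel:
  assumes x: "x \<in> carrier_vec n"
  shows "M *\<^sub>v x = 0\<^sub>v (n - d) \<longleftrightarrow> (\<exists>v\<in>carrier_vec d. \<forall>l<n. x $ l = col D l \<bullet> v)"
proof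
  note M = dim_gale_dual
  assume Mx: "M *\<^sub>v x = 0\<^sub>v (n - d)"
  have rows: "(\<Sum>l<n. r $ l * x $ l) = 0" if r: "r \<in> set (rows M)" for r
  proof -
    obtain k where k: "k < n - d" "r = row M k"
      using r carrier_matD(1)[OF M] by (auto simp: rows_def)
    then have "(M *\<^sub>v x) $ k = 0" unfolding Mx by simp
    then show ?thesis using k M x by (simp add: scalar_prod_def lessThan_atLeast0)
  qed
  have orth: "(\<Sum>l<n. w $ l * x $ l) = 0" if w: "w \<in> mat_kernel D" for w
  proof -
    have "w \<in> K.span (set (rows M))" using gale_unfold(3) w unfolding K.Ker.basis_def by simp
    then obtain a A where wA: "w = K.lincomb a A" "finite A" "A \<subseteq> set (rows M)"
      unfolding K.Ker.span_def by auto
    have "(\<Sum>l<n. w $ l * x $ l) = (\<Sum>l<n. (\<Sum>r\<in>A. a r * r $ l) * x $ l)"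
      using K.lincomb_index[of _ A a] wA rows_in_kernel by (intro sum.cong) auto
    also have "\<dots> = (\<Sum>r\<in>A. a r * (\<Sum>l<n. r $ l * x $ l))"
      by (simp add: sum_distrib_left sum_distrib_right mult.assoc sum.swap[of _ A])
    also have "\<dots> = 0" using rows wA(3) by (intro sum.neutral) auto
    finally show ?thesis .
  qed
  obtain P where P: "P \<in> Fs" using Fs_nonempty by blast
  obtain v where v: "v \<in> carrier_vec d" "\<And>i. slack P (($) x) i = x $ i + col D i \<bullet> v"
    using slack_eq_translate[OF P] by blast
  have "x $ i + col D i \<bullet> v = 0" if "i < n" for i
  proof (cases "i \<in> P")
    case True
    then show ?thesis using v(2) slack_zero[OF P] by metis
  next
    case False
    have "slack P (($) x) i = 0"
      using kernel_vec_pairing[OF P that False, of "($) x"] orth[OF kernel_vec_in_kernel[OF P that False]]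
      by simp
    then show ?thesis using v(2) by simp
  qed
  then show "\<exists>v\<in>carrier_vec d. \<forall>l<n. x $ l = col D l \<bullet> v"
    using v(1) by (intro bexI[of _ "(- 1) \<cdot>\<^sub>v v"])
      (auto simp: scalar_prod_smult_distrib[where n = d] eq_neg_iff_add_eq_0)
next
  note M = dim_gale_dual
  assume "\<exists>v\<in>carrier_vec d. \<forall>l<n. x $ l = col D l \<bullet> v"
  then obtain v where v: "v \<in> carrier_vec d" "\<And>l. l < n \<Longrightarrow> x $ l = col D l \<bullet> v" by blast
  show "M *\<^sub>v x = 0\<^sub>v (n - d)"
  proof (rule eq_vecI)
    fix k assume "k < dim_vec (0\<^sub>v (n - d) :: real vec)"
    then have k: "k < n - d" by simp
    have r: "row M k \<in> mat_kernel D" using rows_in_kernel k M by (auto simp: rows_def)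
    have "(M *\<^sub>v x) $ k = (\<Sum>l<n. row M k $ l * x $ l)"
      using k M x by (simp add: scalar_prod_def lessThan_atLeast0)
    also have "\<dots> = (\<Sum>l<n. row M k $ l * (col D l \<bullet> v))" using v(2) by simp
    also have "\<dots> = 0" using r mat_kernel_iff[of "row M k"] mat_kernelD[OF D r] v(1) by blast
    finally show "(M *\<^sub>v x) $ k = 0\<^sub>v (n - d) $ k" using k by simp
  qed (use M in simp)
qed

lemma gale_dual_inj:
  assumes P: "P \<in> Fs" and x: "x \<in> carrier_vec n" "M *\<^sub>v x = 0\<^sub>v (n - d)"
    and zero: "\<And>l. l \<in> P \<Longrightarrow> x $ l = 0"
  shows "x = 0\<^sub>v n"
proof -
  obtain v where v: "v \<in> carrier_vec d" "\<And>l. l < n \<Longrightarrow> x $ l = col D l \<bullet> v"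
    using gale_dual_kernel[OF x(1)] x(2) by blast
  have "v = 0\<^sub>v d"
    by (rule row_space_eqI[OF P v(1)]) (use zero v(2) Fs_subset[OF P] in force)
  then show ?thesis using v(2) x(1) by (intro eq_vecI) auto
qed

lemma gale_dual_surj:
  assumes y: "y \<in> carrier_vec (n - d)"
  shows "\<exists>x\<in>carrier_vec n. M *\<^sub>v x = y"
proof -
  note M = dim_gale_dual
  obtain P where P: "P \<in> Fs" using Fs_nonempty by blast
  define ls where "ls = sorted_list_of_set ({..<n} - P)"
  have ls: "length ls = n - d" "distinct ls" "set ls = {..<n} - P"
    using card_Diff_subset[OF finite_P[OF P] Fs_subset[OF P]] Fs_card[OF P] by (auto simp: ls_def)
  \<comment> \<open>\<open>S\<close> embeds the space of dimension \<open>n - d\<close> as the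
    coordinates off \<open>P\<close>; there \<open>M\<close> is injective by
    \<open>gale_dual_inj\<close>, so the square matrix \<open>M * S\<close> is invertible.\<close>
  define S :: "real mat" where "S = mat n (n - d) (\<lambda>(l, q). if l = ls ! q then 1 else 0)"
  have S: "S \<in> carrier_mat n (n - d)" by (simp add: S_def)
  have Sw: "(S *\<^sub>v w) $ l = (\<Sum>q<n - d. if l = ls ! q then w $ q else 0)"
    if "w \<in> carrier_vec (n - d)" "l < n" for w l
    using that by (auto simp: S_def scalar_prod_def lessThan_atLeast0 intro!: sum.cong)
  have "\<exists>w\<in>carrier_vec (n - d). (M * S) *\<^sub>v w = y"
  proof (rule square_system_solvable[OF _ _ y])
    show "M * S \<in> carrier_mat (n - d) (n - d)" using M S by simp
    fix w assume w: "w \<in> carrier_vec (n - d)" "M * S *\<^sub>v w = 0\<^sub>v (n - d)"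
    have "S *\<^sub>v w = 0\<^sub>v n"
    proof (rule gale_dual_inj[OF P])
      show "S *\<^sub>v w \<in> carrier_vec n" using S w by simp
      show "M *\<^sub>v (S *\<^sub>v w) = 0\<^sub>v (n - d)" using w(2) assoc_mult_mat_vec[OF M S w(1)] by simp
      show "(S *\<^sub>v w) $ l = 0" if "l \<in> P" for l
      proof -
        have "l \<noteq> ls ! q" if "q < n - d" for q using nth_mem[of q ls] ls that \<open>l \<in> P\<close> by auto
        then show ?thesis using Sw[OF w(1), of l] that Fs_subset[OF P] by (auto intro!: sum.neutral)
      qed
    qed
    moreover have "(S *\<^sub>v w) $ (ls ! q) = w $ q" if q: "q < n - d" for q
    proof -
      have "ls ! q < n" using nth_mem[of q ls] ls q by auto
      then have "(S *\<^sub>v w) $ (ls ! q) = (\<Sum>q'<n - d. if q' = q then w $ q else 0)"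
        using ls q by (subst Sw[OF w(1)]) (auto simp: nth_eq_iff_index_eq intro!: sum.cong)
      then show ?thesis using q by simp
    qed
    moreover have "ls ! q < n" if "q < n - d" for q using nth_mem[of q ls] ls that by auto
    ultimately show "w = 0\<^sub>v (n - d)" using w(1) by (intro eq_vecI) (metis carrier_vecD index_zero_vec, simp)
  qed
  then obtain w where "w \<in> carrier_vec (n - d)" "(M * S) *\<^sub>v w = y" by blast
  then show ?thesis using assoc_mult_mat_vec[OF M S] S by (intro bexI[of _ "S *\<^sub>v w"]) auto
qed

section \<open>Independence, intersection and covering of the cones\<close>

lemma cone_cols_eq:
  assumes "I \<subseteq> {..<n}"
  shows "cone_cols M I =
    {M *\<^sub>v x | x. x \<in> carrier_vec n \<and> (\<forall>i<n. i \<notin> I \<longrightarrow> x $ i = 0) \<and> (\<forall>i\<in>I. 0 \<le> x $ i)}"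
    (is "_ = ?R")
proof -
  note M = dim_gale_dual
  have fin: "finite I" using assms finite_subset by blast
  have comb: "finsum_vec TYPE(real) (dim_row M) (\<lambda>i. x i \<cdot>\<^sub>v col M i) I =
      M *\<^sub>v vec n (\<lambda>i. if i \<in> I then x i else 0)" (is "?l = ?r") for x
  proof (rule eq_vecI)
    have c: "(\<lambda>i. x i \<cdot>\<^sub>v col M i) \<in> I \<rightarrow> carrier_vec (dim_row M)" by auto
    show "dim_vec ?l = dim_vec ?r" using finsum_vec_closed[OF c] M by simp
    fix k assume "k < dim_vec ?r"
    then have k: "k < dim_row M" by simp
    have "?l $ k = (\<Sum>i\<in>I. x i * M $$ (k, i))"
      using index_finsum_vec[OF fin k c] assms k M by (auto intro!: sum.cong)
    also have "\<dots> = (\<Sum>i\<in>{..<n} \<inter> I. x i * M $$ (k, i))" using assms by (simp add: Int_absorb1)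
    also have "\<dots> = ?r $ k" using k M
      by (auto simp: scalar_prod_def sum.inter_restrict lessThan_atLeast0 intro!: sum.cong)
    finally show "?l $ k = ?r $ k" .
  qed
  show ?thesis
  proof (intro equalityI subsetI)
    fix y assume "y \<in> cone_cols M I"
    then obtain x where x: "\<forall>i\<in>I. 0 \<le> x i" "y = M *\<^sub>v vec n (\<lambda>i. if i \<in> I then x i else 0)"
      unfolding cone_cols_def comb by blast
    then show "y \<in> ?R" using assms by (intro CollectI exI[of _ "vec n (\<lambda>i. if i \<in> I then x i else 0)"]) auto
  next
    fix y assume "y \<in> ?R"
    then obtain x where x: "y = M *\<^sub>v x" "x \<in> carrier_vec n" "\<forall>i<n. i \<notin> I \<longrightarrow> x $ i = 0" "\<forall>i\<in>I. 0 \<le> x $ i"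
      by blast
    then have "x = vec n (\<lambda>i. if i \<in> I then x $ i else 0)" by (intro eq_vecI) auto
    then have "y = M *\<^sub>v vec n (\<lambda>i. if i \<in> I then x $ i else 0)" using x(1) by simp
    then show "y \<in> cone_cols M I" unfolding cone_cols_def comb using x(4)
      by (intro CollectI exI[of _ "\<lambda>i. x $ i"] conjI)
  qed
qed

text \<open>A relation among the columns in \<open>I\<close>, extended by zero, lies in the kernel
  of \<open>M\<close> and vanishes on \<open>P\<close>, so \<open>gale_dual_inj\<close> kills
  it.\<close>

lemma lin_indpt_cols_face:
  assumes I: "I \<subseteq> {..<n}" and P: "P \<in> Fs" "P \<inter> I = {}"
  shows "lin_indpt_cols M I"
proof -
  note M = dim_gale_dual
  have fin: "finite I" using I finite_subset by blast
  have coeffs_zero: "z i = 0" if z: "\<And>k. k < n - d \<Longrightarrow> (\<Sum>i\<in>I. z i * M $$ (k, i)) = 0" and "i \<in> I" for z i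
  proof -
    let ?x = "vec n (\<lambda>i. if i \<in> I then z i else 0)"
    have "?x = 0\<^sub>v n"
    proof (rule gale_dual_inj[OF P(1)])
      show "M *\<^sub>v ?x = 0\<^sub>v (n - d)"
      proof (rule eq_vecI)
        fix k assume "k < dim_vec (0\<^sub>v (n - d) :: real vec)"
        then have k: "k < n - d" by simp
        have "(M *\<^sub>v ?x) $ k = (\<Sum>i\<in>{..<n} \<inter> I. z i * M $$ (k, i))" using k M
          by (auto simp: scalar_prod_def sum.inter_restrict lessThan_atLeast0 intro!: sum.cong)
        also have "\<dots> = 0" using z[OF k] I by (simp add: Int_absorb1)
        finally show "(M *\<^sub>v ?x) $ k = 0\<^sub>v (n - d) $ k" using k by simp
      qed (use M in simp)
      show "?x $ l = 0" if "l \<in> P" for l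
      proof -
        have "l < n" "l \<notin> I" using that P(2) Fs_subset[OF P(1)] by blast+
        then show ?thesis by simp
      qed
    qed simp
    then have "?x $ i = 0" using that(2) I by auto
    then show ?thesis using that(2) I by auto
  qed
  have inj: "inj_on (col M) I"
  proof (rule inj_onI, rule ccontr)
    fix i j assume ij: "i \<in> I" "j \<in> I" "col M i = col M j" "i \<noteq> j"
    \<comment> \<open>Two equal columns would give the relation with coefficients 1 and -1.\<close>
    define z :: "nat \<Rightarrow> real" where "z = (\<lambda>l. if l = i then 1 else if l = j then - 1 else 0)"
    have "z i = 0"
    proof (rule coeffs_zero[OF _ ij(1)])
      fix k assume k: "k < n - d"
      have "(\<Sum>l\<in>I. z l * M $$ (k, l)) =
          (\<Sum>l\<in>I. (if l = i then M $$ (k, i) else 0) - (if l = j then M $$ (k, j) else 0))"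
        using ij(4) by (intro sum.cong) (auto simp: z_def)
      also have "\<dots> = M $$ (k, i) - M $$ (k, j)" using ij fin by (simp add: sum_subtractf)
      also have "\<dots> = col M i $ k - col M j $ k"
        using subsetD[OF I ij(1)] subsetD[OF I ij(2)] k M by simp
      finally show "(\<Sum>l\<in>I. z l * M $$ (k, l)) = 0"
        using ij(3) by simp
    qed
    then show False by (simp add: z_def)
  qed
  interpret V: vec_space "TYPE(real)" "dim_row M" .
  have cols: "col M ` I \<subseteq> carrier_vec (dim_row M)" by auto
  have "V.lin_indpt (col M ` I)"
  proof (rule V.finite_lin_indpt2)
    fix a assume a: "V.lincomb a (col M ` I) = 0\<^sub>v (dim_row M)"
    have "a (col M i) = 0" if "i \<in> I" for i
    proof (rule coeffs_zero[of "\<lambda>i. a (col M i)", OF _ that])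
      fix k assume k: "k < n - d"
      have "0 = V.lincomb a (col M ` I) $ k" using a k M by (simp add: module_vec_simps)
      also have "\<dots> = (\<Sum>i\<in>I. a (col M i) * col M i $ k)"
        using k M cols by (subst V.lincomb_index) (auto simp: sum.reindex[OF inj])
      also have "\<dots> = (\<Sum>i\<in>I. a (col M i) * M $$ (k, i))"
        using k M I by (intro sum.cong) auto
      finally show "(\<Sum>i\<in>I. a (col M i) * M $$ (k, i)) = 0" by simp
    qed
    then show "\<forall>v\<in>col M ` I. a v = 0" by simp
  qed (use fin cols in auto)
  then show ?thesis using inj unfolding lin_indpt_cols_def by simp
qed

text \<open>Two nonnegative representatives \<open>x\<close>, \<open>x'\<close> of a common point
  differ by a row-space element \<open>x' - x\<close>. It equals \<open>x'\<close> on
  \<open>P\<close> and \<open>- x\<close> on \<open>P'\<close>, so the sign property makes it zero,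
  and \<open>x = x'\<close> is supported on \<open>I \<inter> J\<close>.\<close>

lemma cone_inter:
  assumes I: "I \<subseteq> {..<n}" "P \<in> Fs" "P \<inter> I = {}" and J: "J \<subseteq> {..<n}" "P' \<in> Fs" "P' \<inter> J = {}"
  shows "cone_cols M I \<inter> cone_cols M J = cone_cols M (I \<inter> J)"
proof (intro equalityI subsetI)
  note M = dim_gale_dual
  fix y assume "y \<in> cone_cols M I \<inter> cone_cols M J"
  then obtain x x' where x: "y = M *\<^sub>v x" "x \<in> carrier_vec n" "\<forall>i<n. i \<notin> I \<longrightarrow> x $ i = 0" "\<forall>i\<in>I. 0 \<le> x $ i"
    and x': "y = M *\<^sub>v x'" "x' \<in> carrier_vec n" "\<forall>i<n. i \<notin> J \<longrightarrow> x' $ i = 0" "\<forall>i\<in>J. 0 \<le> x' $ i"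
    unfolding cone_cols_eq[OF I(1)] cone_cols_eq[OF J(1)] by blast
  have "M *\<^sub>v (x' - x) = 0\<^sub>v (n - d)"
    using mult_minus_distrib_mat_vec[OF M x'(2) x(2)] x(1) x'(1) M by auto
  then obtain v where v: "v \<in> carrier_vec d" "\<And>l. l < n \<Longrightarrow> x' $ l - x $ l = col D l \<bullet> v"
    using gale_dual_kernel[of "x' - x"] x(2) x'(2) by auto
  have nonneg: "0 \<le> x $ l" "0 \<le> x' $ l" if "l < n" for l
    using x(3,4) x'(3,4) that by (metis order_refl)+
  have "v = 0\<^sub>v d"
  proof (rule separated[OF v(1) I(2) J(2)])
    fix j assume "j \<in> P"
    then have "j < n" "j \<notin> I" using I Fs_subset by auto
    then show "0 \<le> col D j \<bullet> v" using v(2)[of j] x(3) nonneg(2)[of j] by simp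
  next
    fix j assume "j \<in> P'"
    then have "j < n" "j \<notin> J" using J Fs_subset by auto
    then show "col D j \<bullet> v \<le> 0" using v(2)[of j] x'(3) nonneg(1)[of j] by simp
  qed
  then have "x' $ l = x $ l" if "l < n" for l using v(2)[OF that] by simp
  then have "\<forall>i<n. i \<notin> I \<inter> J \<longrightarrow> x $ i = 0" using x(3) x'(3) by auto
  moreover have "I \<inter> J \<subseteq> {..<n}" using I by auto
  ultimately show "y \<in> cone_cols M (I \<inter> J)"
    unfolding cone_cols_eq[OF \<open>I \<inter> J \<subseteq> {..<n}\<close>] using x by auto
next
  fix y assume "y \<in> cone_cols M (I \<inter> J)"
  moreover have IJ: "I \<inter> J \<subseteq> {..<n}" using I by auto
  ultimately obtain x where x: "y = M *\<^sub>v x" "x \<in> carrier_vec n"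
      "\<forall>i<n. i \<notin> I \<inter> J \<longrightarrow> x $ i = 0" "\<forall>i\<in>I \<inter> J. 0 \<le> x $ i"
    unfolding cone_cols_eq[OF IJ] by blast
  then have "\<forall>i<n. 0 \<le> x $ i" by (metis order_refl)
  then have "\<forall>i\<in>I. 0 \<le> x $ i" "\<forall>i\<in>J. 0 \<le> x $ i" using I(1) J(1) by blast+
  then show "y \<in> cone_cols M I \<inter> cone_cols M J"
    unfolding cone_cols_eq[OF I(1)] cone_cols_eq[OF J(1)] using x(1-3) by blast
qed

lemma cone_cover:
  assumes y: "y \<in> carrier_vec (n - d)"
  shows "\<exists>P\<in>Fs. y \<in> cone_cols M ({..<n} - P)"
proof -
  note M = dim_gale_dual
  obtain x where x: "x \<in> carrier_vec n" "M *\<^sub>v x = y" using gale_dual_surj[OF y] by blast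
  obtain P where P: "P \<in> Fs" "\<And>i. i < n \<Longrightarrow> 0 \<le> slack P (($) x) i"
    using covered unfolding covered_def by blast
  obtain v where v: "v \<in> carrier_vec d" "\<And>i. slack P (($) x) i = x $ i + col D i \<bullet> v"
    using slack_eq_translate[OF P(1)] by blast
  define z where "z = vec n (slack P (($) x))"
  have z: "z \<in> carrier_vec n" by (simp add: z_def)
  have "\<forall>l<n. (z - x) $ l = col D l \<bullet> v" using v(2) x(1) by (simp add: z_def)
  then have "M *\<^sub>v (z - x) = 0\<^sub>v (n - d)"
    using gale_dual_kernel[of "z - x"] z x(1) v(1) by auto
  then have eq: "M *\<^sub>v z - y = 0\<^sub>v (n - d)" using mult_minus_distrib_mat_vec[OF M z x(1)] x(2) by simp
  have "y = M *\<^sub>v z"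
  proof (rule eq_vecI)
    fix k assume k: "k < dim_vec (M *\<^sub>v z)"
    then have "(M *\<^sub>v z - y) $ k = 0" unfolding eq using M by simp
    then show "y $ k = (M *\<^sub>v z) $ k" using k y M by simp
  qed (use y M in simp)
  moreover have "\<forall>i<n. i \<notin> {..<n} - P \<longrightarrow> z $ i = 0" using slack_zero[OF P(1)] by (simp add: z_def)
  moreover have "\<forall>i\<in>{..<n} - P. 0 \<le> z $ i" using P(2) by (simp add: z_def)
  ultimately show ?thesis using P(1) z by (intro bexI[of _ P]) (auto simp: cone_cols_eq)
qed

theorem gale_dual_complete_fan:
  assumes Q: "length Q = n" "cox_length w0 = d"
    and faces: "\<And>I. I \<in> subword_complex Q \<longleftrightarrow> I \<subseteq> {..<n} \<and> (\<exists>P\<in>Fs. P \<inter> I = {})"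
  shows "complete_fan_realizing Q M"
  unfolding complete_fan_realizing_def Q
proof (intro conjI ballI)
  note M = dim_gale_dual
  show "M \<in> carrier_mat (n - d) n" by (rule M)
  show "lin_indpt_cols M I" if "I \<in> subword_complex Q" for I
    using that lin_indpt_cols_face unfolding faces by blast
  show "cone_cols M I \<inter> cone_cols M J = cone_cols M (I \<inter> J)"
    if "I \<in> subword_complex Q" "J \<in> subword_complex Q" for I J
    using that cone_inter unfolding faces by blast
  show "\<Union> (fan Q M) = carrier_vec (n - d)"
  proof (intro equalityI subsetI)
    fix y assume "y \<in> \<Union> (fan Q M)"
    then obtain I where "I \<in> subword_complex Q" "y \<in> cone_cols M I" unfolding fan_def by blast
    then have "I \<subseteq> {..<n}" "y \<in> cone_cols M I" unfolding faces by blast+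
    then show "y \<in> carrier_vec (n - d)" using M by (auto simp: cone_cols_eq)
  next
    fix y :: "real vec" assume "y \<in> carrier_vec (n - d)"
    then obtain P where P: "P \<in> Fs" "y \<in> cone_cols M ({..<n} - P)" using cone_cover by blast
    moreover have "{..<n} - P \<in> subword_complex Q" using P(1) unfolding faces by blast
    ultimately show "y \<in> \<Union> (fan Q M)" unfolding fan_def by blast
  qed
qed

end

end

section \<open>The parameter matrix\<close>

lemma concat_replicate_123:
  "length (concat (replicate m [1, 2, 3 :: nat])) = 3 * m"
  "j < 3 * m \<Longrightarrow> concat (replicate m [1, 2, 3]) ! j = j mod 3 + 1"
proof -
  show len: "length (concat (replicate m [1, 2, 3 :: nat])) = 3 * m" for m
    by (induction m) auto
  show "j < 3 * m \<Longrightarrow> concat (replicate m [1, 2, 3]) ! j = j mod 3 + 1"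
  proof (induction m arbitrary: j)
    case (Suc m)
    show ?case
    proof (cases "j < 3")
      case True
      then consider "j = 0" | "j = 1" | "j = 2" by linarith
      then show ?thesis by cases auto
    next
      case False
      then obtain j' where "j = 3 + j'" using le_Suc_ex not_less by blast
      moreover have "concat (replicate (Suc m) [1, 2, 3 :: nat]) = [1, 2, 3] @ concat (replicate m [1, 2, 3])"
        by simp
      moreover have "length [1, 2, 3 :: nat] = 3" by simp
      ultimately have "concat (replicate (Suc m) [1, 2, 3 :: nat]) ! j = concat (replicate m [1, 2, 3]) ! j'"
        by (metis nth_append_length_plus)
      then show ?thesis using Suc.IH[of j'] Suc.prems \<open>j = 3 + j'\<close> by simp
    qed
  qed simp
qed

text \<open>Index of the parameters used in column \<open>j\<close>: positions start at 0, while the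
  blocks run from \<open>m\<close> down to 1.\<close>

definition block_index :: "nat \<Rightarrow> nat \<Rightarrow> nat" where
  "block_index m j = m - j div 3"

definition blocks :: "nat \<Rightarrow> nat set \<Rightarrow> nat \<Rightarrow> nat set" where
  "blocks m P r = block_index m ` {j\<in>P. j mod 3 = r}"

lemma blocks_subsetI:
  "(\<And>j. j \<in> P \<Longrightarrow> j mod 3 = r \<Longrightarrow> block_index m j \<in> S) \<Longrightarrow> blocks m P r \<subseteq> S"
  by (auto simp: blocks_def)

text \<open>Along the word the block index falls weakly, and strictly whenever the letter does not
  increase, since each block reads 1, 2, 3. This decides which inequalities of
  \<open>w0_pattern\<close> are strict.\<close>

lemma facet_complement_pattern:
  assumes P: "P \<in> facet_complements (concat (replicate m [1, 2, 3]))"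
  shows "w0_pattern (blocks m P 0) (blocks m P 1) (blocks m P 2)"
proof -
  define Q where "Q = concat (replicate m [1, 2, 3 :: nat])"
  note Q = concat_replicate_123[where m = m, folded Q_def]
  have ws: "nths Q P \<in> set longest_words"
    using P unfolding facet_complements_def Q_def by blast
  have sub: "subseq [1, 2, 3] (nths Q P)" "subseq [3, 2, 1] (nths Q P)"
      "subseq [2, 1, 3, 2] (nths Q P) \<or> subseq [2, 3, 1, 2] (nths Q P)"
    using longest_words_subseqs ws by blast+
  have less: "block_index m j' < block_index m j"
    if "j < j'" "j' mod 3 \<le> j mod 3" "j' < 3 * m" for j j'
  proof -
    have "j div 3 < j' div 3" using that(1,2) by presburger
    moreover have "j' div 3 < m" using that(3) by presburger
    ultimately show ?thesis unfolding block_index_def by linarith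
  qed
  have le: "block_index m j' \<le> block_index m j" if "j < j'" for j j'
    unfolding block_index_def using that by (intro diff_le_mono2 div_le_mono) simp
  have mem: "block_index m j \<in> blocks m P r" if "j \<in> P" "j < 3 * m" "Q ! j = r + 1" for j r
    using that Q(2)[of j] unfolding blocks_def by simp
  have m3: "j mod 3 = r" if "j < 3 * m" "Q ! j = r + 1" for j r
    using that Q(2)[of j] by simp
  \<comment> \<open>The subword 123 read from right to left, hence by increasing block index,
    becomes 321.\<close>
  have p321: "\<exists>k\<in>blocks m P 2. \<exists>j\<in>blocks m P 1. \<exists>i\<in>blocks m P 0. k \<le> j \<and> j \<le> i"
  proof -
    obtain js where js: "sorted_wrt (<) js" "set js \<subseteq> P \<inter> {..<length Q}" "map ((!) Q) js = [1, 2, 3]"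
      using subseq_nths_positions[OF sub(1)] .
    then obtain x y z where xyz: "js = [x, y, z]" "Q ! x = 1" "Q ! y = 2" "Q ! z = 3"
      by (auto simp: map_eq_Cons_conv)
    have in_P: "x \<in> P" "y \<in> P" "z \<in> P" "x < 3 * m" "y < 3 * m" "z < 3 * m" "x < y" "y < z"
      using js(1,2) xyz(1) Q(1) by auto
    have "block_index m x \<in> blocks m P 0" "block_index m y \<in> blocks m P 1" "block_index m z \<in> blocks m P 2"
      using in_P xyz mem[of x 0] mem[of y 1] mem[of z 2] by simp_all
    then show ?thesis using le[of x y] le[of y z] in_P by blast
  qed
  have p123: "\<exists>i\<in>blocks m P 0. \<exists>j\<in>blocks m P 1. \<exists>k\<in>blocks m P 2. i < j \<and> j < k"
  proof -
    obtain js where js: "sorted_wrt (<) js" "set js \<subseteq> P \<inter> {..<length Q}" "map ((!) Q) js = [3, 2, 1]"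
      using subseq_nths_positions[OF sub(2)] .
    then obtain x y z where xyz: "js = [x, y, z]" "Q ! x = 3" "Q ! y = 2" "Q ! z = 1"
      by (auto simp: map_eq_Cons_conv)
    have in_P: "x \<in> P" "y \<in> P" "z \<in> P" "x < 3 * m" "y < 3 * m" "z < 3 * m" "x < y" "y < z"
      using js(1,2) xyz(1) Q(1) by auto
    have "x mod 3 = 2" "y mod 3 = 1" "z mod 3 = 0"
      using in_P xyz m3[of x 2] m3[of y 1] m3[of z 0] by simp_all
    then have "block_index m z < block_index m y" "block_index m y < block_index m x"
      using less[of x y] less[of y z] in_P by simp_all
    moreover have "block_index m x \<in> blocks m P 2" "block_index m y \<in> blocks m P 1" "block_index m z \<in> blocks m P 0"
      using in_P xyz mem[of x 2] mem[of y 1] mem[of z 0] by simp_all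
    ultimately show ?thesis by blast
  qed
  \<comment> \<open>The letters 1 and 3 are compared only with the enclosing letters 2, so their
    mutual order does not matter and both subwords give the same inequalities.\<close>
  have "\<exists>l\<in>blocks m P 1. \<exists>u\<in>blocks m P 1. \<exists>i\<in>blocks m P 0. \<exists>k\<in>blocks m P 2.
      l \<le> i \<and> i < u \<and> l < k \<and> k \<le> u"
    using sub(3)
  proof
    assume "subseq [2, 1, 3, 2] (nths Q P)"
    then obtain js where js: "sorted_wrt (<) js" "set js \<subseteq> P \<inter> {..<length Q}" "map ((!) Q) js = [2, 1, 3, 2]"
      by (rule subseq_nths_positions)
    then obtain x y z w where xyz: "js = [x, y, z, w]" "Q ! x = 2" "Q ! y = 1" "Q ! z = 3" "Q ! w = 2"
      by (auto simp: map_eq_Cons_conv)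
    have in_P: "x \<in> P" "y \<in> P" "z \<in> P" "w \<in> P" "x < 3 * m" "y < 3 * m" "z < 3 * m" "w < 3 * m"
        "x < y" "y < z" "z < w"
      using js(1,2) xyz(1) Q(1) by auto
    have "x mod 3 = 1" "y mod 3 = 0" "z mod 3 = 2" "w mod 3 = 1"
      using in_P xyz m3[of x 1] m3[of y 0] m3[of z 2] m3[of w 1] by simp_all
    then have "block_index m w \<le> block_index m y" "block_index m y < block_index m x"
        "block_index m w < block_index m z" "block_index m z \<le> block_index m x"
      using in_P less[of x y] less[of z w] le[of y w] le[of x z] by simp_all
    moreover have "block_index m x \<in> blocks m P 1" "block_index m y \<in> blocks m P 0"
        "block_index m z \<in> blocks m P 2" "block_index m w \<in> blocks m P 1"
      using in_P xyz mem[of x 1] mem[of y 0] mem[of z 2] mem[of w 1] by simp_all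
    ultimately show ?thesis by blast
  next
    assume "subseq [2, 3, 1, 2] (nths Q P)"
    then obtain js where js: "sorted_wrt (<) js" "set js \<subseteq> P \<inter> {..<length Q}" "map ((!) Q) js = [2, 3, 1, 2]"
      by (rule subseq_nths_positions)
    then obtain x z y w where xyz: "js = [x, z, y, w]" "Q ! x = 2" "Q ! y = 1" "Q ! z = 3" "Q ! w = 2"
      by (auto simp: map_eq_Cons_conv)
    have in_P: "x \<in> P" "y \<in> P" "z \<in> P" "w \<in> P" "x < 3 * m" "y < 3 * m" "z < 3 * m" "w < 3 * m"
        "x < z" "z < y" "y < w"
      using js(1,2) xyz(1) Q(1) by auto
    have "x mod 3 = 1" "y mod 3 = 0" "z mod 3 = 2" "w mod 3 = 1"
      using in_P xyz m3[of x 1] m3[of y 0] m3[of z 2] m3[of w 1] by simp_all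
    then have "block_index m w \<le> block_index m y" "block_index m y < block_index m x"
        "block_index m w < block_index m z" "block_index m z \<le> block_index m x"
      using in_P less[of x y] less[of z w] le[of y w] le[of x z] by simp_all
    moreover have "block_index m x \<in> blocks m P 1" "block_index m y \<in> blocks m P 0"
        "block_index m z \<in> blocks m P 2" "block_index m w \<in> blocks m P 1"
      using in_P xyz mem[of x 1] mem[of y 0] mem[of z 2] mem[of w 1] by simp_all
    ultimately show ?thesis by blast
  qed
  then show ?thesis unfolding w0_pattern_def using p321 p123 by blast
qed

text \<open>The leading coefficients are in the ratio \<open>1 : -2 : 1\<close> and the linear ones sum to zero.\<close>

lemma col_D_123:
  assumes v: "v \<in> carrier_vec 6" and j: "j < 3 * m"
  defines "i \<equiv> block_index m j"
  shows "j mod 3 = 0 \<Longrightarrow> col (D_123 m a b c) j \<bullet> v =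
      v $ 0 + (v $ 1 + v $ 2 / 2) * a i + (v $ 2 / 2) * (a i)\<^sup>2"
    and "j mod 3 = 1 \<Longrightarrow> col (D_123 m a b c) j \<bullet> v =
      (v $ 3 + (real m + 1) * v $ 1) + (v $ 4 - v $ 1 + (real m + 1) * v $ 2) * b i + (- 2 * (v $ 2 / 2)) * (b i)\<^sup>2"
    and "j mod 3 = 2 \<Longrightarrow> col (D_123 m a b c) j \<bullet> v =
      (v $ 5 + (real m + 1) * v $ 4 + (real m + 1) * (real m + 2) / 2 * v $ 2)
      + (- v $ 4 - (2 * real m + 3) / 2 * v $ 2) * c i + (v $ 2 / 2) * (c i)\<^sup>2"
proof -
  have "col (D_123 m a b c) j \<bullet> v = (\<Sum>k\<in>{0..<6}. D_123 m a b c $$ (k, j) * v $ k)"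
    using v j by (simp add: scalar_prod_def D_123_def)
  also have "\<dots> = (\<Sum>k\<in>{0..<6}. D_block m (a i) (b i) (c i) $$ (k, j mod 3) * v $ k)"
    using j by (intro sum.cong) (auto simp: D_123_def Let_def i_def block_index_def)
  finally have eq: "col (D_123 m a b c) j \<bullet> v =
      (\<Sum>k\<in>{0..<6}. D_block m (a i) (b i) (c i) $$ (k, j mod 3) * v $ k)" .
  have "{0..<6} = {0, 1, 2, 3, 4, 5 :: nat}" by auto
  note eq = eq[unfolded this]
  note simps = D_block_def mat_of_rows_list_def gchoose_2_real
  show "j mod 3 = 0 \<Longrightarrow> col (D_123 m a b c) j \<bullet> v =
      v $ 0 + (v $ 1 + v $ 2 / 2) * a i + (v $ 2 / 2) * (a i)\<^sup>2"
    unfolding eq by (simp add: simps) (simp add: field_simps power2_eq_square)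
  show "j mod 3 = 1 \<Longrightarrow> col (D_123 m a b c) j \<bullet> v =
      (v $ 3 + (real m + 1) * v $ 1) + (v $ 4 - v $ 1 + (real m + 1) * v $ 2) * b i + (- 2 * (v $ 2 / 2)) * (b i)\<^sup>2"
    unfolding eq by (simp add: simps) (simp add: field_simps power2_eq_square)
  show "j mod 3 = 2 \<Longrightarrow> col (D_123 m a b c) j \<bullet> v =
      (v $ 5 + (real m + 1) * v $ 4 + (real m + 1) * (real m + 2) / 2 * v $ 2)
      + (- v $ 4 - (2 * real m + 3) / 2 * v $ 2) * c i + (v $ 2 / 2) * (c i)\<^sup>2"
    unfolding eq by (simp add: simps) (simp add: field_simps power2_eq_square)
qed


theorem theorem8p1:
  fixes m :: nat and a b c :: "nat \<Rightarrow> real" and Q :: "nat list" and M :: "real mat"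
  assumes "m \<ge> 3"
    and "Q = concat (replicate m [1, 2, 3])"
    and "\<forall>i\<in>{2..m}. a i - a (i - 1) > 0 \<and> b i - b (i - 1) > 0 \<and> c i - c (i - 1) > 0"
    and "\<forall>i\<in>{2..m}. \<forall>j\<in>{2..m}. i \<noteq> j \<longrightarrow>
           2 * b i - c i - a (i - 1) + 2 * b j - c j - a (j - 1) > 0"
    and "\<forall>i\<in>{1..m - 1}. \<forall>j\<in>{1..m - 1}. i \<noteq> j \<longrightarrow>
           c (i + 1) + a i - 2 * b i + c (j + 1) + a j - 2 * b j > 0"
    and "gale_dual (D_123 m a b c) M"
  shows "complete_fan_realizing Q M"
proof -
  interpret params: signature_parameters m a b c
    using assms(3-5) by unfold_locales
  have Q: "length Q = 3 * m" "\<And>j. j < 3 * m \<Longrightarrow> Q ! j = j mod 3 + 1"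
    using concat_replicate_123 assms(2) by simp_all
  interpret sign_separated 6 "3 * m" "D_123 m a b c" "facet_complements Q"
  proof unfold_locales
    show "D_123 m a b c \<in> carrier_mat 6 (3 * m)" by (simp add: D_123_def)
    \<comment> \<open>The word 123121 takes its last letter from the third copy of 123.\<close>
    obtain k where "m = Suc (Suc (Suc k))" using assms(1) by (metis Suc_le_D numeral_3_eq_3 Suc_le_mono)
    then have "subseq [1, 2, 3, 1, 2, 1] Q" using assms(2) by simp
    moreover have "[1, 2, 3, 1, 2, 1] \<in> set longest_words" by (simp add: longest_words_def)
    ultimately have "{} \<in> subword_complex Q"
      unfolding subword_complex_def reduced_expression_w0 by (auto simp: nths_all)
    then show "facet_complements Q \<noteq> {}" unfolding subword_complex_iff by blast
    show "P \<subseteq> {..<3 * m}" if "P \<in> facet_complements Q" for P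
      using that Q(1) by (simp add: facet_complements_def)
    show "card P = 6" if "P \<in> facet_complements Q" for P
      using that by (rule card_facet_complement)
    show "\<exists>j\<in>P. insert i P - {j} \<in> facet_complements Q"
      if "P \<in> facet_complements Q" "i < 3 * m" "i \<notin> P" for P i
    proof (rule facet_complements_exchange)
      have "i mod 3 = 0 \<or> i mod 3 = 1 \<or> i mod 3 = 2" by linarith
      then show "Q ! i \<in> {1, 2, 3}" using Q(2)[OF that(2)] by auto
    qed (use that Q(1) in auto)
  next
    fix v P P'
    assume v: "v \<in> carrier_vec 6" and P: "P \<in> facet_complements Q" and P': "P' \<in> facet_complements Q"
      and nonneg: "\<And>j. j \<in> P \<Longrightarrow> 0 \<le> col (D_123 m a b c) j \<bullet> v"
      and nonpos: "\<And>j. j \<in> P' \<Longrightarrow> col (D_123 m a b c) j \<bullet> v \<le> 0"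
    have bound: "j < 3 * m \<and> block_index m j \<in> {1..m}" if "j \<in> P \<or> j \<in> P'" for j
    proof -
      have "j < 3 * m" using that P P' Q(1) by (auto simp: facet_complements_def)
      moreover from this have "j div 3 < m" by linarith
      ultimately show ?thesis by (auto simp: block_index_def)
    qed
    note col = col_D_123[OF v, where a = a and b = b and c = c]
    let ?F0 = "v $ 0" and ?F1 = "v $ 1 + v $ 2 / 2" and ?F2 = "v $ 2 / 2"
    let ?G0 = "v $ 3 + (real m + 1) * v $ 1" and ?G1 = "v $ 4 - v $ 1 + (real m + 1) * v $ 2"
    let ?H0 = "v $ 5 + (real m + 1) * v $ 4 + (real m + 1) * (real m + 2) / 2 * v $ 2"
      and ?H1 = "- v $ 4 - (2 * real m + 3) / 2 * v $ 2"
    \<comment> \<open>The \<open>v $ 1\<close> and \<open>v $ 4\<close> terms cancel in pairs, and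
      the factors of \<open>v $ 2\<close> add up to 1/2 + (m + 1) - (2m + 3)/2 = 0.\<close>
    have sum0: "?F1 + ?G1 + ?H1 = 0" by (simp add: field_simps)
    have pos: "w0_pattern {i\<in>{1..m}. 0 \<le> ?F0 + ?F1 * a i + ?F2 * (a i)\<^sup>2}
      {i\<in>{1..m}. 0 \<le> ?G0 + ?G1 * b i + (-2 * ?F2) * (b i)\<^sup>2}
      {i\<in>{1..m}. 0 \<le> ?H0 + ?H1 * c i + ?F2 * (c i)\<^sup>2}"
    proof (rule w0_pattern_mono[OF facet_complement_pattern[OF P[unfolded assms(2)]]])
      show "blocks m P 0 \<subseteq> {i\<in>{1..m}. 0 \<le> ?F0 + ?F1 * a i + ?F2 * (a i)\<^sup>2}"
        by (rule blocks_subsetI) (use bound nonneg col(1) in \<open>simp only: mem_Collect_eq, metis\<close>)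
      show "blocks m P 1 \<subseteq> {i\<in>{1..m}. 0 \<le> ?G0 + ?G1 * b i + (-2 * ?F2) * (b i)\<^sup>2}"
        by (rule blocks_subsetI) (use bound nonneg col(2) in \<open>simp only: mem_Collect_eq, metis\<close>)
      show "blocks m P 2 \<subseteq> {i\<in>{1..m}. 0 \<le> ?H0 + ?H1 * c i + ?F2 * (c i)\<^sup>2}"
        by (rule blocks_subsetI) (use bound nonneg col(3) in \<open>simp only: mem_Collect_eq, metis\<close>)
    qed
    have neg: "w0_pattern {i\<in>{1..m}. ?F0 + ?F1 * a i + ?F2 * (a i)\<^sup>2 \<le> 0}
      {i\<in>{1..m}. ?G0 + ?G1 * b i + (-2 * ?F2) * (b i)\<^sup>2 \<le> 0}
      {i\<in>{1..m}. ?H0 + ?H1 * c i + ?F2 * (c i)\<^sup>2 \<le> 0}"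
    proof (rule w0_pattern_mono[OF facet_complement_pattern[OF P'[unfolded assms(2)]]])
      show "blocks m P' 0 \<subseteq> {i\<in>{1..m}. ?F0 + ?F1 * a i + ?F2 * (a i)\<^sup>2 \<le> 0}"
        by (rule blocks_subsetI) (use bound nonpos col(1) in \<open>simp only: mem_Collect_eq, metis\<close>)
      show "blocks m P' 1 \<subseteq> {i\<in>{1..m}. ?G0 + ?G1 * b i + (-2 * ?F2) * (b i)\<^sup>2 \<le> 0}"
        by (rule blocks_subsetI) (use bound nonpos col(2) in \<open>simp only: mem_Collect_eq, metis\<close>)
      show "blocks m P' 2 \<subseteq> {i\<in>{1..m}. ?H0 + ?H1 * c i + ?F2 * (c i)\<^sup>2 \<le> 0}"
        by (rule blocks_subsetI) (use bound nonpos col(3) in \<open>simp only: mem_Collect_eq, metis\<close>)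
    qed
    \<comment> \<open>The coefficients determine \<open>v\<close>: \<open>?F2\<close>,
      \<open>?F1\<close>, \<open>?F0\<close> give the entries 2, 1, 0, then \<open>?G1\<close>,
      \<open>?G0\<close>, \<open>?H0\<close> give 4, 3, 5.\<close>
    from params.separation[OF sum0 pos neg]
    have zero: "v $ 0 = 0" "v $ 1 = 0" "v $ 2 = 0" "v $ 3 = 0" "v $ 4 = 0" "v $ 5 = 0" by auto
    show "v = 0\<^sub>v 6"
    proof (rule eq_vecI)
      fix k assume "k < dim_vec (0\<^sub>v 6 :: real vec)"
      then have "k \<in> {0, 1, 2, 3, 4, 5}" by auto
      then show "v $ k = 0\<^sub>v 6 $ k" using zero by auto
    qed (use v in simp)
  qed
  show ?thesis
    by (rule gale_dual_complete_fan[OF assms(6) Q(1) cox_length_w0])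
      (simp add: subword_complex_iff Q(1))
qed

end
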